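(* For every $0<c<1$ there exists $\eta>0$ such that \[\frac{|\mathrm{Forb}^*_{n,\eta}(C_5,c)|}{|\mathrm{Forb}^*_n(C_5,c)|}\to 0\quad (n\to\infty).\]
   Context: $\mathrm{Forb}^*_n(C_5,c)$ denotes the set of graphs on vertex set $[n]$ with $c\binom n2$ edges (rounding ignored) that contain no induced copy of the $5$-cycle $C_5$. For a graph $G$, $\hom(G)$ denotes the size of a largest homogeneous set of $G$, i.e. the largest size of a clique or an independent set in $G$. For $\eta>0$, $\mathrm{Forb}^*_{n,\eta}(C_5,c)$ is the set of $G\in\mathrm{Forb}^*_n(C_5,c)$ with $\hom(G)<\eta n$. *)

theory Defs
  imports Complex_Main "HOL-Library.Ramsey"
begin

text \<open>
  A simple graph with vertex set \<open>V\<close> is given by its edge set \<open>E \<subseteq> [V]\<^bsup>2\<^esup>\<close>.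
\<close>

definition cycle_edges :: "nat \<Rightarrow> nat set set" where
  "cycle_edges k = {{i, Suc i mod k} | i. i < k}"

definition has_induced_copy ::
    "'a set \<Rightarrow> 'a set set \<Rightarrow> 'b set \<Rightarrow> 'b set set \<Rightarrow> bool" where
  "has_induced_copy V E W F \<longleftrightarrow>
     (\<exists>f. inj_on f W \<and> f ` W \<subseteq> V \<and>
          (\<forall>u\<in>W. \<forall>v\<in>W. u \<noteq> v \<longrightarrow> ({f u, f v} \<in> E \<longleftrightarrow> {u, v} \<in> F)))"

definition hom :: "'a set \<Rightarrow> 'a set set \<Rightarrow> nat" where
  "hom V E = Max {card S | S. S \<subseteq> V \<and> (clique S E \<or> indep S E)}"

text \<open>The prescribed number of edges \<open>c (n choose 2)\<close> is rounded down to an integer.\<close>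

definition forb_C5 :: "nat \<Rightarrow> real \<Rightarrow> nat set set set" where
  "forb_C5 n c =
     {E. E \<subseteq> [{1..n}]\<^bsup>2\<^esup> \<and> card E = nat \<lfloor>c * real (n choose 2)\<rfloor> \<and>
         \<not> has_induced_copy {1..n} E {..<5} (cycle_edges 5)}"

definition forb_C5_hom :: "nat \<Rightarrow> real \<Rightarrow> real \<Rightarrow> nat set set set" where
  "forb_C5_hom n \<eta> c = {E \<in> forb_C5 n c. real (hom {1..n} E) < \<eta> * real n}"

end

theory Submission
  imports Defs "HOL-Library.Disjoint_Sets" "HOL-Real_Asymp.Real_Asymp"
begin

text \<open>
  Fix a large \<open>r\<close>, and let every homogeneous set have fewer than \<open>n / r\<^sup>7\<close> vertices.
  Colour edges and non-edges by \<open>True\<close> and \<open>False\<close>; the complement of \<open>C\<^sub>5\<close> is a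
  \<open>C\<^sub>5\<close>, so the two colours play symmetric roles. If \<open>X\<close> contains an induced two-coloured path
  \<open>u w v\<close> (\<open>u w\<close> and \<open>w v\<close> of colour \<open>b\<close>, \<open>u v\<close> not) and \<open>y z\<close> has colour \<open>b\<close>, then one of the
  possible adjacencies between \<open>{u, w, v}\<close> and \<open>{y, z}\<close> creates a \<open>C\<^sub>5\<close>. Hence, if all large subsets of
  \<open>X\<close> contain such paths and \<open>R\<close> is an \<open>r\<close>-set that is homogeneous in colour \<open>b\<close>, a set of pairs
  between \<open>X\<close> and \<open>R\<close> that can be chosen freely has at most \<open>2 |X|\<close> of the \<open>r |X|\<close> elements.

  The vertex set splits, up to a few vertices, into boundedly many small pieces. Either all large
  subsets of a piece contain paths of both colours; then the other pieces are
  cut into homogeneous \<open>r\<close>-sets of any colour by Ramsey's theorem. Or the piece has no path of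
  colour \<open>b\<close>, so it is a disjoint union of many small cliques of that colour; then all its large
  subsets contain paths of the other colour and homogeneous \<open>r\<close>-sets of both colours. So after fixing
  the few pairs inside the pieces, the Sauer-Shelah lemma leaves \<open>exp (o(1) n\<^sup>2)\<close> graphs as
  \<open>r \<rightarrow> \<infinity>\<close>. On the other hand, split graphs alone
  show that there are \<open>exp (\<Omega>(n\<^sup>2))\<close> induced-\<open>C\<^sub>5\<close>-free graphs with the given number of edges.
\<close>

section \<open>Shattered sets\<close>

definition shatters :: "'a set set \<Rightarrow> 'a set \<Rightarrow> bool" where
  "shatters F S \<longleftrightarrow> (\<forall>T\<subseteq>S. \<exists>A\<in>F. A \<inter> S = T)"

text \<open>Pajor's form, by induction on the ground set. Sets shattered by the traces
  \<open>P\<close> are shattered by \<open>F\<close>, and sets shattered by the doubly extendable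
  traces \<open>Q\<close> stay shattered after adding \<open>x\<close>. The two kinds are told apart
  by \<open>x\<close>, which matches \<open>card F = card P + card Q\<close>.\<close>

lemma sauer_shelah:
  assumes "finite U" "F \<subseteq> Pow U"
  shows "card F \<le> card {S. S \<subseteq> U \<and> shatters F S}"
  using assms
proof (induction U arbitrary: F rule: finite_induct)
  case empty
  show ?case
  proof (cases "F = {}")
    case False
    then have "F = {{}}" using empty.prems by auto
    moreover have "shatters {{}} {}" by (simp add: shatters_def)
    ultimately have "{S. S \<subseteq> {} \<and> shatters F S} = {{}}" by blast
    then show ?thesis using \<open>F = {{}}\<close> by simp
  qed simp
next
  case (insert x U)
  define P where "P = {A. A \<subseteq> U \<and> (A \<in> F \<or> insert x A \<in> F)}"
  define Q where "Q = {A. A \<subseteq> U \<and> A \<in> F \<and> insert x A \<in> F}"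
  define F0 where "F0 = {A \<in> F. x \<notin> A}"
  define F1 where "F1 = {A. A \<subseteq> U \<and> insert x A \<in> F}"
  have fin: "finite P" "finite Q" "finite F0" "finite F1"
    using insert.hyps insert.prems finite_subset[OF insert.prems]
    by (auto simp: P_def Q_def F0_def F1_def)
  have F0U: "F0 = {A \<in> F. A \<subseteq> U}"
    using insert by (auto simp: F0_def)
  have Feq: "F = F0 \<union> insert x ` F1"
  proof (intro equalityI subsetI)
    fix A assume A: "A \<in> F"
    show "A \<in> F0 \<union> insert x ` F1"
    proof (cases "x \<in> A")
      case True
      then have ins: "insert x (A - {x}) = A" by blast
      moreover have "A - {x} \<subseteq> U" using A insert.prems by blast
      ultimately have "A - {x} \<in> F1" using A by (simp add: F1_def)
      then show ?thesis using ins by (metis UnI2 imageI)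
    qed (use A in \<open>auto simp: F0_def\<close>)
  qed (auto simp: F0_def F1_def)
  have inj: "inj_on (insert x) F1"
    using insert.hyps(2) by (auto simp: inj_on_def F1_def)
  have "card F = card F0 + card (insert x ` F1)"
    unfolding Feq by (subst card_Un_disjoint) (use fin in \<open>auto simp: F0_def\<close>)
  also have "\<dots> = card F0 + card F1"
    using inj by (simp add: card_image)
  also have "\<dots> = card (F0 \<union> F1) + card (F0 \<inter> F1)"
    using fin by (intro card_Un_Int)
  also have "F0 \<union> F1 = P"
    unfolding F0U by (auto simp: F1_def P_def)
  also have "F0 \<inter> F1 = Q"
    unfolding F0U by (auto simp: F1_def Q_def)
  finally have c: "card F = card P + card Q" .
  let ?SP = "{S. S \<subseteq> U \<and> shatters P S}" and ?SQ = "{S. S \<subseteq> U \<and> shatters Q S}"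
  have "card P \<le> card ?SP" "card Q \<le> card ?SQ"
    by (rule insert.IH; auto simp: P_def Q_def)+
  moreover have "card (insert x ` ?SQ) = card ?SQ"
    using insert.hyps(2) by (intro card_image) (auto simp: inj_on_def)
  moreover have "card (?SP \<union> insert x ` ?SQ) = card ?SP + card (insert x ` ?SQ)"
    using insert.hyps by (intro card_Un_disjoint) auto
  moreover have "?SP \<union> insert x ` ?SQ \<subseteq> {S. S \<subseteq> insert x U \<and> shatters F S}"
  proof -
    have "shatters F S" if S: "S \<subseteq> U" "shatters P S" for S
      unfolding shatters_def
    proof (intro allI impI)
      fix T assume "T \<subseteq> S"
      then obtain A where "A \<in> P" "A \<inter> S = T" using S(2) unfolding shatters_def by blast
      moreover from this have "insert x A \<inter> S = T" using S(1) insert.hyps(2) by auto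
      ultimately show "\<exists>A\<in>F. A \<inter> S = T" unfolding P_def by blast
    qed
    moreover have "shatters F (insert x S)" if S: "S \<subseteq> U" "shatters Q S" for S
      unfolding shatters_def
    proof (intro allI impI)
      fix T assume T: "T \<subseteq> insert x S"
      then have "T - {x} \<subseteq> S" by auto
      then obtain A where A: "A \<in> Q" "A \<inter> S = T - {x}" using S(2) unfolding shatters_def by blast
      show "\<exists>A\<in>F. A \<inter> insert x S = T"
      proof (cases "x \<in> T")
        case True
        then have "insert x A \<inter> insert x S = T" using A T by auto
        then show ?thesis using A(1) unfolding Q_def by blast
      next
        case False
        then have "A \<inter> insert x S = T" using A T insert.hyps(2) by (auto simp: Q_def)
        then show ?thesis using A(1) unfolding Q_def by blast
      qed
    qed
    ultimately show ?thesis by auto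
  qed
  then have "card (?SP \<union> insert x ` ?SQ) \<le> card {S. S \<subseteq> insert x U \<and> shatters F S}"
    using insert.hyps(1) by (intro card_mono) auto
  ultimately show ?case using c by linarith
qed

text \<open>Chernoff's trick: the bound follows by comparing with \<open>(1 + x) ^ card U\<close>.\<close>

lemma sauer_shelah_exp:
  fixes x :: real
  assumes "finite U" "F \<subseteq> Pow U" "0 < x" "x \<le> 1"
    and S: "\<And>S. S \<subseteq> U \<Longrightarrow> shatters F S \<Longrightarrow> card S \<le> s"
  shows "real (card F) \<le> (1 + x) ^ card U / x ^ s"
proof -
  let ?N = "card U"
  let ?\<S> = "{S. S \<subseteq> U \<and> shatters F S}"
  have fin: "finite ?\<S>" using assms(1) by simp
  have "real (card F) * x ^ s \<le> real (card ?\<S>) * x ^ s"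
    using sauer_shelah[OF assms(1,2)] assms(3) by (intro mult_right_mono) auto
  also have "\<dots> = (\<Sum>S\<in>?\<S>. x ^ s)" by simp
  also have "\<dots> \<le> (\<Sum>S\<in>?\<S>. x ^ card S)"
    using S assms(3,4) by (intro sum_mono power_decreasing) auto
  also have "\<dots> \<le> (\<Sum>S\<in>Pow U. x ^ card S)"
    using assms by (intro sum_mono2) auto
  \<comment> \<open>Expansion of the product of \<open>x + 1\<close> over \<open>U\<close>: a subset
    selects the factors that contribute \<open>x\<close>.\<close>
  also have "\<dots> = (\<Sum>S\<in>Pow U. (\<Prod>i\<in>S. x) * (\<Prod>i\<in>U-S. 1))" by simp
  also have "\<dots> = (\<Prod>i\<in>U. x + 1)"
    using prod_add[OF assms(1), of "\<lambda>_. x" "\<lambda>_. 1"] by simp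
  also have "\<dots> = (1 + x) ^ ?N" by (simp add: add.commute)
  finally show ?thesis using assms(3) by (simp add: field_simps)
qed

section \<open>Paths and homogeneous sets\<close>

text \<open>The Boolean is a colour: \<open>True\<close> for edges, \<open>False\<close> for
  non-edges. For \<open>False\<close> the pattern is an edge with an isolated vertex, the complement
  of an induced path.\<close>

definition path3 :: "'a set set \<Rightarrow> bool \<Rightarrow> 'a set \<Rightarrow> bool" where
  "path3 E b A \<longleftrightarrow> (\<exists>u\<in>A. \<exists>w\<in>A. \<exists>v\<in>A. u \<noteq> w \<and> w \<noteq> v \<and> u \<noteq> v \<and>
     ({u, w} \<in> E \<longleftrightarrow> b) \<and> ({w, v} \<in> E \<longleftrightarrow> b) \<and> ({u, v} \<in> E \<longleftrightarrow> \<not> b))"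

definition homog :: "'a set set \<Rightarrow> bool \<Rightarrow> 'a set \<Rightarrow> bool" where
  "homog E b A \<longleftrightarrow> (\<forall>x\<in>A. \<forall>y\<in>A. x \<noteq> y \<longrightarrow> ({x, y} \<in> E \<longleftrightarrow> b))"

lemma homogD: "homog E b A \<Longrightarrow> x \<in> A \<Longrightarrow> y \<in> A \<Longrightarrow> x \<noteq> y \<Longrightarrow> ({x, y} \<in> E \<longleftrightarrow> b)"
  by (simp add: homog_def)

lemma homog_clique_indep: "homog E True A \<longleftrightarrow> clique A E" "homog E False A \<longleftrightarrow> indep A E"
  by (auto simp: homog_def clique_def indep_def)

lemma path3_mono: "path3 E b A \<Longrightarrow> A \<subseteq> B \<Longrightarrow> path3 E b B"
  unfolding path3_def by blast

lemma not_path3D: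
  assumes "\<not> path3 E b A" "u \<in> A" "w \<in> A" "v \<in> A" "{u, w} \<in> E \<longleftrightarrow> b" "{w, v} \<in> E \<longleftrightarrow> b"
    "u \<noteq> w" "w \<noteq> v" "u \<noteq> v"
  shows "{u, v} \<in> E \<longleftrightarrow> b"
  using assms unfolding path3_def by blast

text \<open>Without paths of a colour, being equal or joined in that colour is transitive. If this
  holds for both colours, one pair \<open>u\<close>, \<open>v\<close> of colour \<open>b\<close>
  spreads \<open>b\<close> to every pair at \<open>u\<close>, and from there to all pairs.\<close>

lemma homog_if_no_path3:
  assumes "\<not> path3 E b A" "\<not> path3 E (\<not> b) A"
  shows "homog E b A \<or> homog E (\<not> b) A"
proof (cases "homog E (\<not> b) A")
  case False
  then obtain u v where uv: "u \<in> A" "v \<in> A" "u \<noteq> v" "{u, v} \<in> E \<longleftrightarrow> b"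
    unfolding homog_def by blast
  have u: "{u, w} \<in> E \<longleftrightarrow> b" if w: "w \<in> A" "w \<noteq> u" for w
  proof (cases "w = v")
    case False
    show ?thesis
    proof (rule ccontr)
      assume n: "\<not> ({u, w} \<in> E \<longleftrightarrow> b)"
      have "\<not> ({v, w} \<in> E \<longleftrightarrow> b)"
        using not_path3D[OF assms(1), of u v w] uv w n False by auto
      then show False
        using not_path3D[OF assms(2), of u w v] uv w n False by (auto simp: insert_commute)
    qed
  qed (use uv in simp)
  have "{w, w'} \<in> E \<longleftrightarrow> b" if w: "w \<in> A" "w' \<in> A" "w \<noteq> w'" for w w'
    using u[of w] u[of w'] w not_path3D[OF assms(1), of w u w'] uv
    by (cases "w = u"; cases "w' = u") (auto simp: insert_commute)
  then show ?thesis by (auto simp: homog_def)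
qed simp

text \<open>
  A set without induced paths of colour \<open>b\<close> is a disjoint union of cliques of
  colour \<open>b\<close>; a maximal set \<open>I\<close> of the other colour is a transversal of these cliques.
\<close>

lemma homog_subset_if_no_path3:
  assumes "finite B" "\<not> path3 E b B"
    and H: "\<And>A c. A \<subseteq> B \<Longrightarrow> homog E c A \<Longrightarrow> card A \<le> H"
    and B: "r * H < card B"
  obtains R where "R \<subseteq> B" "card R = r" "homog E c R"
proof -
  define \<I> where "\<I> = {I. I \<subseteq> B \<and> homog E (\<not> b) I}"
  have "finite \<I>" "{} \<in> \<I>" using assms(1) by (auto simp: \<I>_def homog_def)
  then obtain I where I: "I \<in> \<I>" and max: "\<And>J. J \<in> \<I> \<Longrightarrow> I \<subseteq> J \<Longrightarrow> I = J"
    using finite_has_maximal[of \<I>] by blast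
  have IB: "I \<subseteq> B" "homog E (\<not> b) I" using I by (auto simp: \<I>_def)
  have finI: "finite I" using IB assms(1) finite_subset by blast
  define C where "C i = {x \<in> B. x = i \<or> ({x, i} \<in> E \<longleftrightarrow> b)}" for i
  have CB: "C i \<subseteq> B" for i by (auto simp: C_def)
  have Cfin: "finite (C i)" for i using CB assms(1) finite_subset by blast
  have cover: "B \<subseteq> (\<Union>i\<in>I. C i)"
  proof
    fix x assume x: "x \<in> B"
    show "x \<in> (\<Union>i\<in>I. C i)"
    proof (rule ccontr)
      assume n: "x \<notin> (\<Union>i\<in>I. C i)"
      then have "x \<notin> I" "\<forall>i\<in>I. {x, i} \<in> E \<longleftrightarrow> \<not> b" using x by (auto simp: C_def)
      then have "insert x I \<in> \<I>"
        using IB x by (auto simp: \<I>_def homog_def insert_commute)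
      with max[of "insert x I"] \<open>x \<notin> I\<close> show False by auto
    qed
  qed
  have Chom: "homog E b (C i)" if "i \<in> I" for i
    unfolding homog_def
  proof (intro ballI impI)
    fix x y assume xy: "x \<in> C i" "y \<in> C i" "x \<noteq> y"
    show "{x, y} \<in> E \<longleftrightarrow> b"
      using not_path3D[OF assms(2), of x i y] xy IB that
      by (cases "x = i"; cases "y = i") (auto simp: C_def insert_commute)
  qed
  have le: "card B \<le> (\<Sum>i\<in>I. card (C i))"
    using card_mono[OF _ cover] card_UN_le[OF finI, of C] finI Cfin by fastforce
  \<comment> \<open>\<open>B\<close> is covered by \<open>card I\<close> cliques, and both
    \<open>card I\<close> and the clique sizes are at most \<open>H\<close>. So
    \<open>r * H < card B\<close> forces \<open>card I\<close> as well as some clique to reach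
    \<open>r\<close>.\<close>
  have "\<exists>A\<subseteq>B. r \<le> card A \<and> homog E c A"
  proof (cases "c = b")
    case True
    have "\<exists>i\<in>I. r \<le> card (C i)"
    proof (rule ccontr)
      assume "\<not> ?thesis"
      then have "(\<Sum>i\<in>I. card (C i)) \<le> card I * r"
        using sum_bounded_above[of I "\<lambda>i. card (C i)" r] by (simp add: nat_le_linear not_le less_imp_le)
      also have "\<dots> \<le> H * r" using H[OF IB] by simp
      finally show False using le B by (simp add: mult.commute)
    qed
    then show ?thesis using CB Chom True by blast
  next
    case False
    have "(\<Sum>i\<in>I. card (C i)) \<le> card I * H"
      using sum_bounded_above[of I "\<lambda>i. card (C i)" H] H[OF CB Chom] by auto
    then have "r * H < card I * H" using le B by linarith
    then have "r \<le> card I" by auto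
    moreover have "homog E c I" using IB False by (cases c; cases b) auto
    ultimately show ?thesis using IB by blast
  qed
  then obtain A where A: "A \<subseteq> B" "r \<le> card A" "homog E c A" by blast
  from obtain_subset_with_card_n[OF A(2)] obtain R where "R \<subseteq> A" "card R = r" by metis
  moreover from this have "homog E c R" using A(3) by (auto simp: homog_def)
  ultimately show ?thesis using A(1) that by blast
qed

section \<open>The five-cycle and its copies in either colour\<close>

lemma lessThan_5: "{..<5::nat} = {0, 1, 2, 3, 4}"
  by auto

lemma cycle_edges_5: "cycle_edges 5 = {{0, 1}, {1, 2}, {2, 3}, {3, 4}, {4, 0}}"
proof -
  have "cycle_edges 5 = (\<lambda>i. {i, Suc i mod 5}) ` {..<5}" by (auto simp: cycle_edges_def)
  moreover have "Suc 0 mod 5 = 1" "Suc 1 mod 5 = 2" "Suc 2 mod 5 = 3" "Suc 3 mod 5 = 4" "Suc 4 mod 5 = 0"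
    by simp_all
  ultimately show ?thesis unfolding lessThan_5 image_insert image_empty by metis
qed

text \<open>The names separate the path \<open>u\<close>, \<open>w\<close>, \<open>v\<close> from
  the pair \<open>y\<close>, \<open>z\<close> that closes it to the cycle \<open>u w v z y\<close>
  of colour \<open>b\<close>.\<close>

lemma induced_C5:
  assumes sub: "{u, w, v, y, z} \<subseteq> V"
    and dist: "distinct [u, w, v, y, z]"
    and b: "{u, w} \<in> E \<longleftrightarrow> b" "{w, v} \<in> E \<longleftrightarrow> b" "{v, z} \<in> E \<longleftrightarrow> b" "{z, y} \<in> E \<longleftrightarrow> b"
      "{y, u} \<in> E \<longleftrightarrow> b"
    and nb: "{u, v} \<in> E \<longleftrightarrow> \<not> b" "{u, z} \<in> E \<longleftrightarrow> \<not> b" "{w, y} \<in> E \<longleftrightarrow> \<not> b"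
      "{w, z} \<in> E \<longleftrightarrow> \<not> b" "{v, y} \<in> E \<longleftrightarrow> \<not> b"
  shows "has_induced_copy V E {..<5} (cycle_edges 5)"
proof -
  \<comment> \<open>The complement of the cycle \<open>0, 1, 2, 3, 4\<close> is the cycle \<open>0, 2, 4, 1, 3\<close>.\<close>
  define L where "L = (if b then [u, w, v, z, y] else [u, v, y, w, z])"
  have L: "L ! 0 = u" "L ! 1 = (if b then w else v)" "L ! 2 = (if b then v else y)"
    "L ! 3 = (if b then z else w)" "L ! 4 = (if b then y else z)"
    by (simp_all add: L_def)
  have sw: "{w, u} = {u, w}" "{v, w} = {w, v}" "{z, v} = {v, z}" "{y, z} = {z, y}" "{u, y} = {y, u}"
    "{v, u} = {u, v}" "{z, u} = {u, z}" "{y, w} = {w, y}" "{z, w} = {w, z}" "{y, v} = {v, y}"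
    by blast+
  have "inj_on ((!) L) {..<5}"
    using dist by (intro inj_on_nth) (auto simp: L_def)
  moreover have "(!) L ` {..<5} \<subseteq> V"
    using sub unfolding lessThan_5 image_insert L by auto
  moreover have "\<forall>i\<in>{..<5}. \<forall>j\<in>{..<5}. i \<noteq> j \<longrightarrow> ({L ! i, L ! j} \<in> E \<longleftrightarrow> {i, j} \<in> cycle_edges 5)"
    unfolding lessThan_5 cycle_edges_5 ball_simps L
    by (cases b) (simp_all add: b nb sw doubleton_eq_iff)
  ultimately show ?thesis
    unfolding has_induced_copy_def by blast
qed

section \<open>Partition into pieces\<close>

text \<open>Here and below sizes are compared after multiplication by powers of \<open>r\<close>, to
  stay within the natural numbers. The exponent 3 beats the at most \<open>r ^ 2\<close> pairs of
  columns in \<open>shattered_block\<close> with a factor \<open>r\<close> to spare.\<close>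

definition rich :: "'a set set \<Rightarrow> nat \<Rightarrow> bool \<Rightarrow> 'a set \<Rightarrow> bool" where
  "rich E r b X \<longleftrightarrow> (\<forall>A\<subseteq>X. card X < r ^ 3 * card A \<longrightarrow> path3 E b A)"

text \<open>The relation is not symmetric: \<open>X\<close> supplies the paths, \<open>Y\<close> the
  homogeneous sets, and the colour may change with \<open>B\<close>. With exponent 5 the leftovers,
  summed over up to \<open>r ^ 4\<close> pieces, cost only a \<open>1 / r\<close> fraction of
  \<open>n ^ 2\<close>.\<close>

definition compatible :: "'a set set \<Rightarrow> nat \<Rightarrow> nat \<Rightarrow> 'a set \<Rightarrow> 'a set \<Rightarrow> bool" where
  "compatible E r n X Y \<longleftrightarrow> (\<forall>B\<subseteq>Y. n \<le> r ^ 5 * card B \<longrightarrow>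
     (\<exists>R\<subseteq>B. card R = r \<and> (\<exists>b. rich E r b X \<and> homog E b R)))"

definition piece :: "'a set set \<Rightarrow> nat \<Rightarrow> nat \<Rightarrow> 'a set \<Rightarrow> bool" where
  "piece E r m X \<longleftrightarrow> card X \<le> m \<and> m \<le> r ^ 3 * card X \<and>
     ((\<forall>b. rich E r b X) \<or> (\<exists>b. \<not> path3 E b X))"

text \<open>The number of pieces is bounded in \<open>r\<close> alone, so for fixed \<open>r\<close>
  there are only \<open>exp (O(n))\<close> such families. The bounds on the pieces and the leftover
  keep the pairs that are fixed in advance few.\<close>

definition arrangement :: "'a set \<Rightarrow> 'a set set \<Rightarrow> nat \<Rightarrow> 'a set set \<Rightarrow> bool" where
  "arrangement V E r \<Q> \<longleftrightarrow> \<Q> \<subseteq> Pow V \<and> disjoint \<Q> \<and> card \<Q> \<le> r ^ 4 \<and>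
     (\<forall>X\<in>\<Q>. card X \<le> card V div r + 1) \<and> card (V - \<Union>\<Q>) \<le> card V div r + 1 \<and>
     (\<forall>X\<in>\<Q>. \<forall>Y\<in>\<Q>. X \<noteq> Y \<longrightarrow> compatible E r (card V) X Y \<or> compatible E r (card V) Y X)"

text \<open>A large subset of \<open>X\<close> that misses a path of some colour is a piece; if
  there is none, \<open>X\<close> itself is rich in both colours.\<close>

lemma piece_exists:
  assumes "finite X" "card X = m" "r > 0"
  obtains A where "A \<subseteq> X" "piece E r m A"
proof (cases "\<exists>A\<subseteq>X. card X < r ^ 3 * card A \<and> (\<exists>b. \<not> path3 E b A)")
  case True
  then obtain A b where A: "A \<subseteq> X" "card X < r ^ 3 * card A" "\<not> path3 E b A" by blast
  then show ?thesis
    using that[of A] assms card_mono[OF assms(1) A(1)] by (auto simp: piece_def)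
next
  case False
  then have "\<forall>b. rich E r b X" by (auto simp: rich_def)
  then show ?thesis
    using that[of X] assms by (auto simp: piece_def)
qed

text \<open>Greedy choice: as long as \<open>m\<close> vertices are left, \<open>m\<close> of them
  contain a piece, which is nonempty since \<open>m > 0\<close> and can be removed.\<close>

lemma disjoint_pieces_exist:
  assumes "finite W" "r > 0" "m > 0"
  shows "\<exists>\<Q>. \<Q> \<subseteq> Pow W \<and> disjoint \<Q> \<and> (\<forall>X\<in>\<Q>. piece E r m X) \<and> card (W - \<Union>\<Q>) < m"
  using assms(1)
proof (induction "card W" arbitrary: W rule: less_induct)
  case less
  show ?case
  proof (cases "card W < m")
    case True
    then show ?thesis by (intro exI[of _ "{}"]) auto
  next
    case False
    then obtain X0 where X0: "X0 \<subseteq> W" "card X0 = m"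
      by (meson not_less obtain_subset_with_card_n)
    then obtain A where A: "A \<subseteq> X0" "piece E r m A"
      using piece_exists[of X0 m r E] assms less.prems finite_subset by blast
    have "A \<noteq> {}" using A(2) assms(3) by (auto simp: piece_def)
    have AW: "A \<subseteq> W" using A X0 by blast
    have "card (W - A) < card W"
      using \<open>A \<noteq> {}\<close> AW less.prems by (intro psubset_card_mono) auto
    from less.hyps[OF this] less.prems obtain \<Q> where \<Q>: "\<Q> \<subseteq> Pow (W - A)" "disjoint \<Q>"
      "\<forall>X\<in>\<Q>. piece E r m X" "card (W - A - \<Union>\<Q>) < m"
      by auto
    have "disjoint (insert A \<Q>)"
      using \<Q>(1,2) by (auto simp: disjoint_def)
    moreover have "W - \<Union>(insert A \<Q>) = W - A - \<Union>\<Q>" by auto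
    ultimately show ?thesis
      using \<Q> A AW by (intro exI[of _ "insert A \<Q>"]) auto
  qed
qed

lemma ramsey_homog: "\<exists>N. \<forall>E. \<forall>B :: 'a set. finite B \<and> N \<le> card B \<longrightarrow> (\<exists>R\<subseteq>B. card R = r \<and> (\<exists>b. homog E b R))"
proof -
  obtain N where N: "\<forall>(B::'a set) E. finite B \<and> card B \<ge> N \<longrightarrow>
    (\<exists>R\<subseteq>B. card R = r \<and> clique R E \<or> card R = r \<and> indep R E)"
    using ramsey2[of r r] by blast
  show ?thesis
  proof (intro exI[of _ N] allI impI)
    fix E and B :: "'a set" assume "finite B \<and> N \<le> card B"
    then obtain R where "R \<subseteq> B" "card R = r" "clique R E \<or> indep R E"
      using N by metis
    then show "\<exists>R\<subseteq>B. card R = r \<and> (\<exists>b. homog E b R)"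
      by (metis homog_clique_indep)
  qed
qed

text \<open>A large subset without paths of either colour would be homogeneous. The exponent 7
  arises here as \<open>1 + 3 + 3\<close>: from \<open>n\<close> to \<open>m\<close>, from
  \<open>m\<close> to the piece, and from the piece to its subset.\<close>

lemma rich_if_no_path3:
  assumes "\<not> path3 E b X" "m \<le> r ^ 3 * card X" "n \<le> r * m" "r > 0"
    and H: "\<And>A c. A \<subseteq> X \<Longrightarrow> homog E c A \<Longrightarrow> r ^ 7 * card A < n"
  shows "rich E r (\<not> b) X"
  unfolding rich_def
proof (intro allI impI)
  fix A assume A: "A \<subseteq> X" "card X < r ^ 3 * card A"
  show "path3 E (\<not> b) A"
  proof (rule ccontr)
    assume "\<not> path3 E (\<not> b) A"
    moreover have "\<not> path3 E b A" using assms(1) A(1) path3_mono by blast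
    ultimately have "homog E b A \<or> homog E (\<not> b) A" by (rule homog_if_no_path3[rotated])
    then have "r ^ 7 * card A < n" using H A(1) by blast
    also have "n \<le> r * (r ^ 3 * card X)"
      using assms(2,3) by (meson le_trans mult_le_mono2)
    also have "\<dots> \<le> r * (r ^ 3 * (r ^ 3 * card A))"
      using A(2) by (intro mult_le_mono2) auto
    also have "\<dots> = r ^ 7 * card A" by (simp add: power_numeral_reduce mult.assoc)
    finally show False by simp
  qed
qed

text \<open>If one piece is rich in both colours, it serves as the source of paths, and Ramsey's
  theorem gives homogeneous sets of some colour in the other. Otherwise \<open>X\<close> is rich in
  one colour and \<open>Y\<close> is a union of small cliques, so homogeneous sets of precisely that
  colour exist in large subsets of \<open>Y\<close>.\<close>

lemma compatible_pieces:
  assumes "finite V" "r > 0" "card V \<le> r * m" "card V > 0"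
    and H: "\<And>A c. A \<subseteq> V \<Longrightarrow> homog E c A \<Longrightarrow> r ^ 7 * card A < card V"
    and N: "\<And>B. finite B \<Longrightarrow> N \<le> card B \<Longrightarrow> \<exists>R\<subseteq>B. card R = r \<and> (\<exists>b. homog E b R)"
    and n: "r ^ 5 * N \<le> card V"
    and XY: "X \<subseteq> V" "Y \<subseteq> V" "piece E r m X" "piece E r m Y"
  shows "compatible E r (card V) X Y \<or> compatible E r (card V) Y X"
proof -
  have rich: "compatible E r (card V) X Y" if X: "\<forall>b. rich E r b X" and Y: "Y \<subseteq> V" for X Y
    unfolding compatible_def
  proof (intro allI impI)
    fix B assume B: "B \<subseteq> Y" "card V \<le> r ^ 5 * card B"
    then have "r ^ 5 * N \<le> r ^ 5 * card B" using n by linarith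
    then have "N \<le> card B" using assms(2) by simp
    moreover have "finite B" using B Y assms(1) by (meson finite_subset)
    ultimately show "\<exists>R\<subseteq>B. card R = r \<and> (\<exists>b. rich E r b X \<and> homog E b R)"
      using N X by blast
  qed
  show ?thesis
  proof (cases "(\<forall>b. rich E r b X) \<or> (\<forall>b. rich E r b Y)")
    case True
    then show ?thesis using rich XY by blast
  next
    case False
    then obtain b c where bc: "\<not> path3 E b X" "\<not> path3 E c Y"
      using XY by (auto simp: piece_def)
    have X: "rich E r (\<not> b) X"
      using XY assms(2,3) H by (intro rich_if_no_path3[OF bc(1)]) (auto simp: piece_def)
    have "compatible E r (card V) X Y"
      unfolding compatible_def
    proof (intro allI impI)
      fix B assume B: "B \<subseteq> Y" "card V \<le> r ^ 5 * card B"
      \<comment> \<open>The largest size of a homogeneous set that the strict bound allows; hence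
        the subtraction of 1.\<close>
      define h where "h = (card V - 1) div r ^ 7"
      have h: "card A \<le> h" if "A \<subseteq> B" "homog E d A" for A d
      proof -
        have "A \<subseteq> V" using that B(1) XY(2) by blast
        then have "r ^ 7 * card A < card V" by (rule H[OF _ that(2)])
        then have "card A * r ^ 7 \<le> card V - 1" by (simp add: mult.commute)
        then show ?thesis using assms(2) by (simp add: h_def less_eq_div_iff_mult_less_eq)
      qed
      have "r ^ 5 * (r * h) \<le> r ^ 7 * h"
        using assms(2) by (simp add: power_numeral_reduce)
      also have "\<dots> \<le> card V - 1" unfolding h_def by (rule times_div_less_eq_dividend)
      also have "\<dots> < r ^ 5 * card B" using B(2) assms(4) by linarith
      finally have "r * h < card B" by simp
      moreover have "finite B" using B XY(2) assms(1) by (meson finite_subset)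
      moreover have "\<not> path3 E c B" using bc(2) B(1) path3_mono by blast
      ultimately obtain R where "R \<subseteq> B" "card R = r" "homog E (\<not> b) R"
        using h homog_subset_if_no_path3[of B E c h r "\<not> b"] by metis
      then show "\<exists>R\<subseteq>B. card R = r \<and> (\<exists>b. rich E r b X \<and> homog E b R)"
        using X by blast
    qed
    then show ?thesis ..
  qed
qed

lemma arrangement_exists:
  assumes "finite V" "r > 0" "card V > 0"
    and H: "\<And>A c. A \<subseteq> V \<Longrightarrow> homog E c A \<Longrightarrow> r ^ 7 * card A < card V"
    and N: "\<And>B. finite B \<Longrightarrow> N \<le> card B \<Longrightarrow> \<exists>R\<subseteq>B. card R = r \<and> (\<exists>b. homog E b R)"
    and n: "r ^ 5 * N \<le> card V"
  shows "\<exists>\<Q>. arrangement V E r \<Q>"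
proof -
  define m where "m = card V div r + 1"
  have m: "card V \<le> r * m"
    using mult_div_mod_eq[of r "card V"] mod_less_divisor[of r "card V"] assms(2)
    unfolding m_def distrib_left by linarith
  obtain \<Q> where \<Q>: "\<Q> \<subseteq> Pow V" "disjoint \<Q>" "\<forall>X\<in>\<Q>. piece E r m X" "card (V - \<Union>\<Q>) < m"
    using disjoint_pieces_exist[OF assms(1,2), of m E] by (auto simp: m_def)
  have fin: "finite \<Q>" "\<And>X. X \<in> \<Q> \<Longrightarrow> finite X"
    using \<Q>(1) assms(1) by (auto simp: finite_subset intro: finite_subset)
  \<comment> \<open>Disjoint pieces of at least \<open>m / r ^ 3\<close> vertices within at most
    \<open>r * m\<close> vertices: at most \<open>r ^ 4\<close> of them.\<close>
  have "m * card \<Q> \<le> (\<Sum>X\<in>\<Q>. r ^ 3 * card X)"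
    using \<Q>(3) sum_mono[of \<Q> "\<lambda>_. m" "\<lambda>X. r ^ 3 * card X"] by (simp add: piece_def mult.commute)
  also have "\<dots> = r ^ 3 * (\<Sum>X\<in>\<Q>. card X)" by (simp add: sum_distrib_left)
  also have "(\<Sum>X\<in>\<Q>. card X) = card (\<Union>\<Q>)"
    using \<Q>(2) fin by (subst card_Union_disjoint) (auto simp: disjoint_def pairwise_def disjnt_def)
  also have "r ^ 3 * card (\<Union>\<Q>) \<le> r ^ 3 * card V"
    using \<Q>(1) assms(1) by (intro mult_le_mono2 card_mono) auto
  also have "\<dots> \<le> r ^ 3 * (r * m)"
    using m by (intro mult_le_mono2)
  also have "\<dots> = m * r ^ 4" by (simp add: power_numeral_reduce)
  finally have "m * card \<Q> \<le> m * r ^ 4" .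
  then have "card \<Q> \<le> r ^ 4" by (rule nat_mult_le_cancel1[THEN iffD1, rotated]) (simp add: m_def)
  moreover have "\<forall>X\<in>\<Q>. \<forall>Y\<in>\<Q>. X \<noteq> Y \<longrightarrow> compatible E r (card V) X Y \<or> compatible E r (card V) Y X"
  proof (intro ballI impI)
    fix X Y assume "X \<in> \<Q>" "Y \<in> \<Q>"
    then have "X \<subseteq> V" "Y \<subseteq> V" "piece E r m X" "piece E r m Y" using \<Q>(1,3) by auto
    then show "compatible E r (card V) X Y \<or> compatible E r (card V) Y X"
      by (intro compatible_pieces[OF assms(1,2) m assms(3) H N n])
  qed
  ultimately have "arrangement V E r \<Q>"
    using \<Q> unfolding arrangement_def m_def piece_def by auto
  then show ?thesis ..
qed

section \<open>Shattered sets of pairs between pieces\<close>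

text \<open>The pairs of \<open>S\<close> between \<open>X\<close> and \<open>Y\<close>, seen as
  marked positions in an array with rows \<open>X\<close> and columns \<open>Y\<close>.\<close>

definition cells :: "'a set set \<Rightarrow> 'a set \<Rightarrow> 'a set \<Rightarrow> ('a \<times> 'a) set" where
  "cells S X Y = {(x, y). x \<in> X \<and> y \<in> Y \<and> {x, y} \<in> S}"

lemma finite_cells: "finite X \<Longrightarrow> finite Y \<Longrightarrow> finite (cells S X Y)"
  by (rule finite_subset[of _ "X \<times> Y"]) (auto simp: cells_def)

lemma card_cells_le: "finite X \<Longrightarrow> finite Y \<Longrightarrow> card (cells S X Y) \<le> card X * card Y"
  using card_mono[of "X \<times> Y" "cells S X Y"] by (auto simp: cells_def card_cartesian_product)

definition C5_free :: "'a set \<Rightarrow> 'a set set \<Rightarrow> bool" where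
  "C5_free V E \<longleftrightarrow> \<not> has_induced_copy V E {..<5} (cycle_edges 5)"

text \<open>
  Two columns that are free over an induced path of colour \<open>b\<close> could be filled in so that they
  complete the path to a \<open>5\<close>-cycle of colour \<open>b\<close>.
\<close>

lemma shattered_columns:
  assumes "shatters F S"
    and C5: "\<And>E. E \<in> F \<Longrightarrow> C5_free V E"
    and agree: "\<And>E x y. E \<in> F \<Longrightarrow> x \<noteq> y \<Longrightarrow> x \<in> X \<and> y \<in> X \<or> x \<in> Y \<and> y \<in> Y \<Longrightarrow> {x, y} \<in> E \<longleftrightarrow> {x, y} \<in> E0"
    and XY: "X \<subseteq> V" "Y \<subseteq> V" "X \<inter> Y = {}"
    and y: "y \<in> Y" "z \<in> Y" "y \<noteq> z" "{y, z} \<in> E0 \<longleftrightarrow> b"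
    and A: "A \<subseteq> X" "\<And>x. x \<in> A \<Longrightarrow> {x, y} \<in> S \<and> {x, z} \<in> S"
  shows "\<not> path3 E0 b A"
proof
  assume "path3 E0 b A"
  then obtain u w v where p: "u \<in> A" "w \<in> A" "v \<in> A" "u \<noteq> w" "w \<noteq> v" "u \<noteq> v"
    "{u, w} \<in> E0 \<longleftrightarrow> b" "{w, v} \<in> E0 \<longleftrightarrow> b" "{u, v} \<in> E0 \<longleftrightarrow> \<not> b"
    unfolding path3_def by blast
  \<comment> \<open>The edges to be prescribed among the six free pairs: \<open>v z\<close> and
    \<open>y u\<close> must get colour \<open>b\<close> and the other four the opposite colour, so
    for \<open>b = False\<close> those four become the edges.\<close>
  define T where "T = (if b then {{v, z}, {y, u}} else {{u, z}, {w, y}, {w, z}, {v, y}})"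
  have "T \<subseteq> S" using A(2) p(1-3) by (auto simp: T_def insert_commute)
  then obtain E where E: "E \<in> F" "E \<inter> S = T" using assms(1) unfolding shatters_def by blast
  have S: "e \<in> E \<longleftrightarrow> e \<in> T" if "e \<in> S" for e using E(2) that by blast
  have in_S: "{v, z} \<in> S" "{y, u} \<in> S" "{u, z} \<in> S" "{w, y} \<in> S" "{w, z} \<in> S" "{v, y} \<in> S"
    using A(2) p(1-3) by (auto simp: insert_commute)
  have nX: "y \<notin> X" "z \<notin> X" using XY y by auto
  then have ne: "y \<noteq> u" "y \<noteq> w" "y \<noteq> v" "z \<noteq> u" "z \<noteq> w" "z \<noteq> v"
    using p(1-3) A(1) by auto
  have uX: "u \<in> X" "w \<in> X" "v \<in> X" using p A by auto
  have T: "{v, z} \<in> T \<longleftrightarrow> b" "{y, u} \<in> T \<longleftrightarrow> b" "{u, z} \<in> T \<longleftrightarrow> \<not> b" "{w, y} \<in> T \<longleftrightarrow> \<not> b"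
    "{w, z} \<in> T \<longleftrightarrow> \<not> b" "{v, y} \<in> T \<longleftrightarrow> \<not> b"
    using ne ne[symmetric] p(4-6) p(4-6)[symmetric] y(3) by (auto simp: T_def doubleton_eq_iff)
  have "has_induced_copy V E {..<5} (cycle_edges 5)"
  proof (rule induced_C5[of u w v y z])
    show "{u, w, v, y, z} \<subseteq> V" using uX XY y by auto
    show "distinct [u, w, v, y, z]" using p(4-6) ne y(3) by auto
    show "{u, w} \<in> E \<longleftrightarrow> b" "{w, v} \<in> E \<longleftrightarrow> b" "{u, v} \<in> E \<longleftrightarrow> \<not> b"
      using agree[OF E(1)] p uX by auto
    show "{z, y} \<in> E \<longleftrightarrow> b" using agree[OF E(1), of y z] y by (simp add: insert_commute)
    show "{v, z} \<in> E \<longleftrightarrow> b" "{y, u} \<in> E \<longleftrightarrow> b" "{u, z} \<in> E \<longleftrightarrow> \<not> b" "{w, y} \<in> E \<longleftrightarrow> \<not> b"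
      "{w, z} \<in> E \<longleftrightarrow> \<not> b" "{v, y} \<in> E \<longleftrightarrow> \<not> b"
      using in_S[THEN S] T by auto
  qed
  then show False using C5[OF E(1)] by (simp add: C5_free_def)
qed

text \<open>By \<open>shattered_columns\<close> and richness, each of at most \<open>r ^ 2\<close>
  pairs of columns is jointly marked in at most \<open>card X / r ^ 3\<close> rows. So the rows
  \<open>D\<close> with two marks number at most \<open>card X / r\<close> and contribute at most
  \<open>card X\<close> cells; every other row contributes at most one.\<close>

lemma shattered_block:
  assumes "shatters F S" "finite V" "r > 0"
    and C5: "\<And>E. E \<in> F \<Longrightarrow> C5_free V E"
    and agree: "\<And>E x y. E \<in> F \<Longrightarrow> x \<noteq> y \<Longrightarrow> x \<in> X \<and> y \<in> X \<or> x \<in> R \<and> y \<in> R \<Longrightarrow> {x, y} \<in> E \<longleftrightarrow> {x, y} \<in> E0"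
    and XR: "X \<subseteq> V" "R \<subseteq> V" "X \<inter> R = {}"
    and R: "card R = r" "homog E0 b R" and X: "rich E0 r b X"
  shows "card (cells S X R) \<le> 2 * card X"
proof -
  have fin: "finite X" "finite R" using XR(1,2) assms(2) by (auto intro: finite_subset)
  define D where "D = {x \<in> X. \<exists>y\<in>R. \<exists>z\<in>R. y \<noteq> z \<and> {x, y} \<in> S \<and> {x, z} \<in> S}"
  define A where "A y z = {x \<in> X. {x, y} \<in> S \<and> {x, z} \<in> S}" for y z
  have A: "r ^ 3 * card (A y z) \<le> card X" if yz: "y \<in> R" "z \<in> R" "y \<noteq> z" for y z
  proof -
    have "\<not> path3 E0 b (A y z)"
      using R(2) yz homogD[OF R(2), of y z]
      by (intro shattered_columns[OF assms(1) C5 agree XR, of y z]) (auto simp: A_def)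
    moreover have "A y z \<subseteq> X" by (auto simp: A_def)
    ultimately have "\<not> card X < r ^ 3 * card (A y z)" using X unfolding rich_def by blast
    then show ?thesis by simp
  qed
  define P where "P = {(y, z). y \<in> R \<and> z \<in> R \<and> y \<noteq> z}"
  have PR: "P \<subseteq> R \<times> R" by (auto simp: P_def)
  have P: "finite P" by (rule finite_subset[OF PR]) (use fin in simp)
  have cP: "card P \<le> r\<^sup>2"
    using card_mono[OF _ PR] fin R(1) by (simp add: card_cartesian_product power2_eq_square)
  have "D \<subseteq> (\<Union>p\<in>P. A (fst p) (snd p))"
  proof
    fix x assume "x \<in> D"
    then obtain y z where "x \<in> X" "y \<in> R" "z \<in> R" "y \<noteq> z" "{x, y} \<in> S" "{x, z} \<in> S"
      unfolding D_def by blast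
    then have "(y, z) \<in> P" "x \<in> A (fst (y, z)) (snd (y, z))"
      by (simp_all add: P_def A_def)
    then show "x \<in> (\<Union>p\<in>P. A (fst p) (snd p))" by blast
  qed
  then have "card D \<le> card (\<Union>p\<in>P. A (fst p) (snd p))"
    using P fin by (intro card_mono) (auto simp: A_def)
  also have "\<dots> \<le> (\<Sum>p\<in>P. card (A (fst p) (snd p)))"
    using card_UN_le[OF P] .
  finally have "card D \<le> (\<Sum>p\<in>P. card (A (fst p) (snd p)))" .
  then have "r ^ 3 * card D \<le> r ^ 3 * (\<Sum>p\<in>P. card (A (fst p) (snd p)))"
    by (rule mult_le_mono2)
  also have "\<dots> = (\<Sum>p\<in>P. r ^ 3 * card (A (fst p) (snd p)))"
    by (rule sum_distrib_left)
  also have "\<dots> \<le> (\<Sum>p\<in>P. card X)"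
    using A by (intro sum_mono) (auto simp: P_def)
  also have "\<dots> = card P * card X" by simp
  also have "\<dots> \<le> r\<^sup>2 * card X" using cP by simp
  finally have "r\<^sup>2 * (r * card D) \<le> r\<^sup>2 * card X" by (simp add: power_numeral_reduce mult.assoc)
  then have D: "r * card D \<le> card X" using assms(3) by simp
  have DX: "D \<subseteq> X" "finite D" using fin by (auto simp: D_def)
  \<comment> \<open>A row outside \<open>D\<close> has at most one marked column, so the row
    determines the cell.\<close>
  have "inj_on fst (cells S (X - D) R)"
    by (auto simp: inj_on_def cells_def D_def)
  then have "card (cells S (X - D) R) \<le> card X"
    using fin by (intro card_inj_on_le[of fst]) (auto simp: cells_def)
  moreover have "card (cells S D R) \<le> card D * r"
    using card_cells_le[OF DX(2) fin(2)] R(1) by simp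
  moreover have "cells S X R = cells S (X - D) R \<union> cells S D R"
    using DX by (auto simp: cells_def)
  then have "card (cells S X R) \<le> card (cells S (X - D) R) + card (cells S D R)"
    by (metis card_Un_le)
  ultimately show ?thesis using D by (simp add: mult.commute)
qed

text \<open>Homogeneous \<open>r\<close>-sets are peeled off the columns, each with at most
  \<open>2 * card X\<close> cells, until fewer than \<open>n / r ^ 5\<close> columns remain; these
  are counted in full.\<close>

lemma shattered_pair:
  assumes "shatters F S" "finite V" "r > 0"
    and C5: "\<And>E. E \<in> F \<Longrightarrow> C5_free V E"
    and agree: "\<And>E x y. E \<in> F \<Longrightarrow> x \<noteq> y \<Longrightarrow> x \<in> X \<and> y \<in> X \<or> x \<in> Y \<and> y \<in> Y \<Longrightarrow> {x, y} \<in> E \<longleftrightarrow> {x, y} \<in> E0"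
    and XY: "X \<subseteq> V" "Y \<subseteq> V" "X \<inter> Y = {}"
    and comp: "compatible E0 r n X Y"
  shows "r ^ 5 * card (cells S X Y) \<le> 2 * r ^ 4 * (card X * card Y) + n * card X"
proof -
  have finX: "finite X" using XY(1) assms(2) by (rule finite_subset)
  have "r ^ 5 * card (cells S X B) \<le> 2 * r ^ 4 * (card X * card B) + n * card X" if "B \<subseteq> Y" for B
    using that
  proof (induction "card B" arbitrary: B rule: less_induct)
    case less
    have finB: "finite B" using less.prems XY(2) assms(2) by (meson finite_subset)
    show ?case
    proof (cases "n \<le> r ^ 5 * card B")
      case False
      have "r ^ 5 * card (cells S X B) \<le> r ^ 5 * (card X * card B)"
        using card_cells_le[OF finX finB] by (intro mult_le_mono2)
      also have "\<dots> = (r ^ 5 * card B) * card X" by simp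
      also have "\<dots> \<le> n * card X" using False by (intro mult_le_mono1) simp
      finally show ?thesis by simp
    next
      case True
      then obtain R b where R: "R \<subseteq> B" "card R = r" "rich E0 r b X" "homog E0 b R"
        using comp less.prems unfolding compatible_def by blast
      have finR: "finite R" using R(1) finB finite_subset by blast
      have cB: "card B = card (B - R) + card R"
        using R(1) finB finR by (simp add: card_Diff_subset card_mono)
      have "r ^ 5 * card (cells S X (B - R)) \<le> 2 * r ^ 4 * (card X * card (B - R)) + n * card X"
        using cB R(2) assms(3) less.prems by (intro less.hyps) auto
      moreover have "card (cells S X R) \<le> 2 * card X"
      proof (rule shattered_block[OF assms(1-3) C5 _ XY(1) _ _ R(2,4,3)])
        have RY: "R \<subseteq> Y" using R(1) less.prems by blast
        then show "R \<subseteq> V" "X \<inter> R = {}" using XY by blast+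
        fix E x y assume "E \<in> F" "x \<noteq> y" "x \<in> X \<and> y \<in> X \<or> x \<in> R \<and> y \<in> R"
        then show "{x, y} \<in> E \<longleftrightarrow> {x, y} \<in> E0" using agree[of E x y] RY by blast
      qed
      then have "r ^ 5 * card (cells S X R) \<le> r ^ 5 * (2 * card X)"
        by (intro mult_le_mono2)
      then have "r ^ 5 * card (cells S X R) \<le> 2 * r ^ 4 * (card X * card R)"
        using R(2) by (simp add: power_numeral_reduce mult_ac)
      moreover have "cells S X B = cells S X (B - R) \<union> cells S X R"
        using R(1) by (auto simp: cells_def)
      then have "card (cells S X B) \<le> card (cells S X (B - R)) + card (cells S X R)"
        by (metis card_Un_le)
      then have "r ^ 5 * card (cells S X B) \<le> r ^ 5 * card (cells S X (B - R)) + r ^ 5 * card (cells S X R)"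
        by (metis distrib_left mult_le_mono2)
      ultimately show ?thesis unfolding cB by (simp add: distrib_left)
    qed
  qed
  then show ?thesis by simp
qed

text \<open>The pairs on which a graph may still vary once all other pairs are fixed.\<close>

definition crossing :: "'a set set \<Rightarrow> 'a set set" where
  "crossing \<Q> = {{x, y} | x y. \<exists>X\<in>\<Q>. \<exists>Y\<in>\<Q>. X \<noteq> Y \<and> x \<in> X \<and> y \<in> Y}"

text \<open>Such a pair lies inside one piece or has an end in the leftover; each case accounts for
  at most \<open>card V * m\<close> ordered pairs.\<close>

lemma card_not_crossing:
  assumes "finite V" "\<Q> \<subseteq> Pow V" "disjoint \<Q>" "\<And>X. X \<in> \<Q> \<Longrightarrow> card X \<le> m" "card (V - \<Union>\<Q>) \<le> m"
  shows "card ([V]\<^bsup>2\<^esup> - crossing \<Q>) \<le> 2 * card V * m"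
proof -
  have fin: "finite \<Q>" "\<And>X. X \<in> \<Q> \<Longrightarrow> finite X"
    using assms(1,2) by (auto intro: finite_subset)
  let ?I = "\<Union>X\<in>\<Q>. X \<times> X" and ?J = "(V - \<Union>\<Q>) \<times> V"
  have "[V]\<^bsup>2\<^esup> - crossing \<Q> \<subseteq> (\<lambda>(x, y). {x, y}) ` (?I \<union> ?J)"
  proof
    fix e assume e: "e \<in> [V]\<^bsup>2\<^esup> - crossing \<Q>"
    then obtain x y where xy: "e = {x, y}" "x \<in> V" "y \<in> V"
      by (auto simp: nsets_def card_2_iff)
    show "e \<in> (\<lambda>(x, y). {x, y}) ` (?I \<union> ?J)"
    proof (cases "x \<in> \<Union>\<Q> \<and> y \<in> \<Union>\<Q>")
      case True
      then obtain X Y where XY: "X \<in> \<Q>" "Y \<in> \<Q>" "x \<in> X" "y \<in> Y" by blast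
      have "X = Y"
      proof (rule ccontr)
        assume "X \<noteq> Y"
        then have "e \<in> crossing \<Q>" unfolding crossing_def using XY xy(1) by blast
        then show False using e by blast
      qed
      then have "(x, y) \<in> ?I" using XY by blast
      then show ?thesis using xy by blast
    next
      case False
      then have "(x, y) \<in> ?J \<or> (y, x) \<in> ?J" using xy by blast
      moreover have "{x, y} = {y, x}" by blast
      ultimately show ?thesis unfolding xy(1) by (metis (no_types, lifting) UnI2 case_prod_conv imageI)
    qed
  qed
  moreover have "finite ?I" using fin by blast
  ultimately have "card ([V]\<^bsup>2\<^esup> - crossing \<Q>) \<le> card (?I \<union> ?J)"
    using assms(1) by (intro surj_card_le) auto
  also have "\<dots> \<le> card ?I + card ?J" by (rule card_Un_le)
  also have "card ?J \<le> m * card V"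
    using assms(5) by (simp add: card_cartesian_product)
  also have "card ?I \<le> (\<Sum>X\<in>\<Q>. card (X \<times> X))" by (rule card_UN_le[OF fin(1)])
  also have "\<dots> \<le> (\<Sum>X\<in>\<Q>. card X * m)"
    using assms(4) by (intro sum_mono) (simp add: card_cartesian_product)
  also have "\<dots> = card (\<Union>\<Q>) * m"
    using assms(3) fin by (subst card_Union_disjoint)
      (auto simp: disjoint_def pairwise_def disjnt_def sum_distrib_right)
  also have "\<dots> \<le> card V * m"
    using assms(1,2) by (intro mult_le_mono1 card_mono) auto
  finally show ?thesis by (simp add: algebra_simps)
qed

text \<open>The bound of \<open>shattered_pair\<close> is summed over pairs of pieces: the product
  terms give \<open>2 * r ^ 4 * n ^ 2\<close> and the leftovers \<open>r ^ 4 * n ^ 2\<close>, where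
  \<open>n = card V\<close>. Division by \<open>r ^ 5\<close> leaves
  \<open>3 * n ^ 2 / r\<close>.\<close>

lemma shattered_card:
  assumes "shatters F S" "finite V" "r > 0" "S \<subseteq> [V]\<^bsup>2\<^esup>"
    and Q: "arrangement V E0 r \<Q>"
    and C5: "\<And>E. E \<in> F \<Longrightarrow> C5_free V E"
    and agree: "\<And>E e. E \<in> F \<Longrightarrow> e \<in> [V]\<^bsup>2\<^esup> - crossing \<Q> \<Longrightarrow> e \<in> E \<longleftrightarrow> e \<in> E0"
  shows "card S \<le> 3 * (card V)\<^sup>2 div r"
proof -
  let ?n = "card V"
  have Q': "\<Q> \<subseteq> Pow V" "disjoint \<Q>" "card \<Q> \<le> r ^ 4"
    "\<And>X Y. X \<in> \<Q> \<Longrightarrow> Y \<in> \<Q> \<Longrightarrow> X \<noteq> Y \<Longrightarrow> compatible E0 r ?n X Y \<or> compatible E0 r ?n Y X"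
    using Q unfolding arrangement_def by blast+
  have fin: "finite \<Q>" "\<And>X. X \<in> \<Q> \<Longrightarrow> finite X"
    using Q'(1) assms(2) by (auto intro: finite_subset)
  have disj: "X \<inter> Y = {}" if "X \<in> \<Q>" "Y \<in> \<Q>" "X \<noteq> Y" for X Y
    using Q'(2) that by (auto simp: disjoint_def)
  have agree': "{x, y} \<in> E \<longleftrightarrow> {x, y} \<in> E0"
    if "E \<in> F" "x \<noteq> y" "X \<in> \<Q>" "x \<in> X" "y \<in> X" for E x y X
  proof (rule agree[OF that(1)])
    have "{x, y} \<notin> crossing \<Q>"
    proof
      assume "{x, y} \<in> crossing \<Q>"
      then obtain x' y' X' Y' where c: "{x, y} = {x', y'}" "X' \<in> \<Q>" "Y' \<in> \<Q>" "X' \<noteq> Y'" "x' \<in> X'" "y' \<in> Y'"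
        unfolding crossing_def by blast
      then have "x' \<in> X" "y' \<in> X" using that(4,5) by (auto simp: doubleton_eq_iff)
      then have "X' = X" "Y' = X" using c that(3) disj[of X' X] disj[of Y' X] by blast+
      then show False using c(4) by simp
    qed
    then show "{x, y} \<in> [V]\<^bsup>2\<^esup> - crossing \<Q>" using that Q'(1) by (auto simp: nsets_def)
  qed
  \<comment> \<open>A shattered pair is present in one member of \<open>F\<close> and absent from
    another, whereas all members agree with \<open>E0\<close> on non-crossing pairs.\<close>
  have cross: "S \<subseteq> crossing \<Q>"
  proof
    fix e assume e: "e \<in> S"
    then obtain E E' where E: "E \<in> F" "E \<inter> S = {}" "E' \<in> F" "E' \<inter> S = {e}"
      using assms(1) unfolding shatters_def by (metis empty_subsetI insert_subset)
    then have "e \<notin> E" "e \<in> E'" using e by blast+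
    then show "e \<in> crossing \<Q>" using agree[of E e] agree[of E' e] E e assms(4) by blast
  qed
  \<comment> \<open>Pairs of pieces in a direction in which they are compatible; counting a pair in
    both directions does no harm to an upper bound.\<close>
  define K where "K = {p \<in> \<Q> \<times> \<Q>. fst p \<noteq> snd p \<and> compatible E0 r ?n (fst p) (snd p)}"
  have K: "K \<subseteq> \<Q> \<times> \<Q>" "finite K"
    using fin(1) by (auto simp: K_def)
  have sub: "S \<subseteq> (\<Union>p\<in>K. (\<lambda>q. {fst q, snd q}) ` cells S (fst p) (snd p))"
  proof
    fix e assume e: "e \<in> S"
    then have "e \<in> crossing \<Q>" using cross by blast
    then obtain x y X Y where c: "e = {x, y}" "X \<in> \<Q>" "Y \<in> \<Q>" "X \<noteq> Y" "x \<in> X" "y \<in> Y"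
      unfolding crossing_def by blast
    have *: "e \<in> (\<Union>p\<in>K. (\<lambda>q. {fst q, snd q}) ` cells S (fst p) (snd p))"
      if "X \<in> \<Q>" "Y \<in> \<Q>" "X \<noteq> Y" "x \<in> X" "y \<in> Y" "compatible E0 r ?n X Y" "e = {x, y}" for X Y x y
    proof (rule UN_I[of "(X, Y)"])
      show "(X, Y) \<in> K" using that by (simp add: K_def)
      have "(x, y) \<in> cells S X Y" using that e by (simp add: cells_def)
      then show "e \<in> (\<lambda>q. {fst q, snd q}) ` cells S (fst (X, Y)) (snd (X, Y))"
        using that(7) by (simp add: image_iff) (metis fst_conv snd_conv)
    qed
    have "e = {y, x}" using c(1) by blast
    then show "e \<in> (\<Union>p\<in>K. (\<lambda>q. {fst q, snd q}) ` cells S (fst p) (snd p))"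
      using *[of X Y x y] *[of Y X y x] c Q'(4)[of X Y] by blast
  qed
  have finc: "finite (cells S (fst p) (snd p))" if "p \<in> K" for p
  proof -
    have "fst p \<in> \<Q>" "snd p \<in> \<Q>" using that K(1) by auto
    then show ?thesis using fin(2) by (intro finite_cells)
  qed
  have "card S \<le> card (\<Union>p\<in>K. (\<lambda>q. {fst q, snd q}) ` cells S (fst p) (snd p))"
    using K(2) finc sub by (intro card_mono finite_UN_I finite_imageI)
  also have "\<dots> \<le> (\<Sum>p\<in>K. card ((\<lambda>q. {fst q, snd q}) ` cells S (fst p) (snd p)))"
    by (rule card_UN_le[OF K(2)])
  also have "\<dots> \<le> (\<Sum>p\<in>K. card (cells S (fst p) (snd p)))"
    by (intro sum_mono card_image_le finc)
  finally have "r ^ 5 * card S \<le> r ^ 5 * (\<Sum>p\<in>K. card (cells S (fst p) (snd p)))"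
    by (rule mult_le_mono2)
  also have "\<dots> = (\<Sum>p\<in>K. r ^ 5 * card (cells S (fst p) (snd p)))"
    by (rule sum_distrib_left)
  also have "\<dots> \<le> (\<Sum>p\<in>K. 2 * r ^ 4 * (card (fst p) * card (snd p)) + ?n * card (fst p))"
  proof (rule sum_mono)
    fix p assume "p \<in> K"
    then have p: "fst p \<in> \<Q>" "snd p \<in> \<Q>" "fst p \<noteq> snd p" "compatible E0 r ?n (fst p) (snd p)"
      by (auto simp: K_def)
    show "r ^ 5 * card (cells S (fst p) (snd p)) \<le> 2 * r ^ 4 * (card (fst p) * card (snd p)) + ?n * card (fst p)"
    proof (rule shattered_pair[OF assms(1-3) C5 _ _ _ disj[OF p(1-3)] p(4)])
      show "fst p \<subseteq> V" "snd p \<subseteq> V" using p(1,2) Q'(1) by blast+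
      fix E x y assume "E \<in> F" "x \<noteq> y" "x \<in> fst p \<and> y \<in> fst p \<or> x \<in> snd p \<and> y \<in> snd p"
      then show "{x, y} \<in> E \<longleftrightarrow> {x, y} \<in> E0"
        using agree'[of E x y "fst p"] agree'[of E x y "snd p"] p(1,2) by blast
    qed
  qed
  also have "\<dots> \<le> (\<Sum>p\<in>\<Q>\<times>\<Q>. 2 * r ^ 4 * (card (fst p) * card (snd p)) + ?n * card (fst p))"
    using K(1) fin(1) by (intro sum_mono2) auto
  also have "\<dots> = (\<Sum>X\<in>\<Q>. \<Sum>Y\<in>\<Q>. 2 * r ^ 4 * (card X * card Y) + ?n * card X)"
    by (simp add: sum.cartesian_product case_prod_unfold)
  also have "\<dots> = 2 * r ^ 4 * (\<Sum>X\<in>\<Q>. card X)\<^sup>2 + ?n * card \<Q> * (\<Sum>X\<in>\<Q>. card X)"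
    by (simp add: sum.distrib power2_eq_square sum_product sum_distrib_left mult_ac)
  also have "(\<Sum>X\<in>\<Q>. card X) = card (\<Union>\<Q>)"
    using disj fin by (subst card_Union_disjoint) (auto simp: pairwise_def disjnt_def)
  also have "2 * r ^ 4 * (card (\<Union>\<Q>))\<^sup>2 + ?n * card \<Q> * card (\<Union>\<Q>) \<le> 2 * r ^ 4 * ?n\<^sup>2 + ?n * r ^ 4 * ?n"
  proof -
    have "card (\<Union>\<Q>) \<le> ?n" using Q'(1) assms(2) by (intro card_mono) auto
    then show ?thesis using Q'(3) by (intro add_mono mult_mono power_mono) auto
  qed
  also have "\<dots> = r ^ 4 * (3 * ?n\<^sup>2)" by (simp add: power2_eq_square)
  finally have "r ^ 4 * (r * card S) \<le> r ^ 4 * (3 * ?n\<^sup>2)" by (simp add: power_numeral_reduce mult_ac)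
  then have "card S * r \<le> 3 * ?n\<^sup>2" using assms(3) by (simp add: mult.commute)
  then show ?thesis using assms(3) by (simp add: less_eq_div_iff_mult_less_eq)
qed

section \<open>Counting graphs without large homogeneous sets\<close>

lemma card_small_families:
  assumes "finite V"
  shows "card {\<Q>. \<Q> \<subseteq> Pow V \<and> card \<Q> \<le> k} \<le> (k + 1) * 2 ^ (card V * k)"
proof -
  have "{\<Q>. \<Q> \<subseteq> Pow V \<and> card \<Q> \<le> k} \<subseteq> set ` {xs. set xs \<subseteq> Pow V \<and> length xs \<le> k}"
  proof
    fix \<Q> assume Q: "\<Q> \<in> {\<Q>. \<Q> \<subseteq> Pow V \<and> card \<Q> \<le> k}"
    then have "finite \<Q>" using assms by (auto intro: finite_subset)
    then obtain xs where "set xs = \<Q>" "length xs = card \<Q>"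
      by (metis finite_distinct_list distinct_card)
    then show "\<Q> \<in> set ` {xs. set xs \<subseteq> Pow V \<and> length xs \<le> k}" using Q by auto
  qed
  then have "card {\<Q>. \<Q> \<subseteq> Pow V \<and> card \<Q> \<le> k} \<le> card {xs. set xs \<subseteq> Pow V \<and> length xs \<le> k}"
    using assms by (intro surj_card_le finite_lists_length_le) auto
  also have "\<dots> = (\<Sum>i\<le>k. card (Pow V) ^ i)"
    using assms by (intro card_lists_length_le) auto
  also have "\<dots> \<le> (\<Sum>i\<le>k. card (Pow V) ^ k)"
    using assms by (intro sum_mono power_increasing) (auto simp: card_Pow)
  also have "\<dots> = (k + 1) * 2 ^ (card V * k)"
    using assms by (simp add: card_Pow power_mult)
  finally show ?thesis .
qed

text \<open>Union bound over the arrangement and over the part \<open>w\<close> of the graph outside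
  the crossing pairs. Within one class only crossing pairs vary, and the Sauer-Shelah bound
  applies.\<close>

lemma card_C5_free_small_homog:
  fixes V :: "'a set"
  assumes "finite V" "r > 0" "card V > 0"
    and N: "\<And>E (B :: 'a set). finite B \<Longrightarrow> N \<le> card B \<Longrightarrow> \<exists>R\<subseteq>B. card R = r \<and> (\<exists>b. homog E b R)"
    and n: "r ^ 5 * N \<le> card V"
  shows "real (card {E. E \<subseteq> [V]\<^bsup>2\<^esup> \<and> C5_free V E \<and>
      (\<forall>A c. A \<subseteq> V \<longrightarrow> homog E c A \<longrightarrow> r ^ 7 * card A < card V)})
    \<le> real ((r ^ 4 + 1) * 2 ^ (card V * r ^ 4)) * (2 ^ (2 * card V * (card V div r + 1)) *
       ((1 + 1 / real r) ^ ((card V)\<^sup>2) * real r ^ (3 * (card V)\<^sup>2 div r)))"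
    (is "real (card ?\<B>) \<le> real ?a * (?b * ?c)")
proof -
  let ?n = "card V"
  let ?D = "\<lambda>\<Q>. [V]\<^bsup>2\<^esup> - crossing \<Q>"
  define P where "P = {\<Q>. \<exists>E. arrangement V E r \<Q>}"
  define F where "F \<Q> w = {E \<in> ?\<B>. arrangement V E r \<Q> \<and> E \<inter> ?D \<Q> = w}" for \<Q> w
  have finU: "finite ([V]\<^bsup>2\<^esup>)" by (rule finite_imp_finite_nsets[OF assms(1)])
  have cardU: "card ([V]\<^bsup>2\<^esup>) \<le> ?n\<^sup>2"
  proof -
    have "card ([V]\<^bsup>2\<^esup>) = ?n * (?n - 1) div 2" by (simp add: card_nsets choose_two)
    also have "\<dots> \<le> ?n * (?n - 1)" by (rule div_le_dividend)
    also have "\<dots> \<le> ?n\<^sup>2" by (simp add: power2_eq_square)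
    finally show ?thesis .
  qed
  have P: "P \<subseteq> {\<Q>. \<Q> \<subseteq> Pow V \<and> card \<Q> \<le> r ^ 4}"
    by (auto simp: P_def arrangement_def)
  have finP: "finite P"
    by (rule finite_subset[OF P], rule finite_subset[of _ "Pow (Pow V)"]) (use assms(1) in auto)
  have cF: "real (card (F \<Q> w)) \<le> ?c" for \<Q> w
  proof (cases "F \<Q> w = {}")
    case False
    \<comment> \<open>Any member serves as reference graph \<open>E0\<close>, because all members of
      the class have the same non-crossing pairs.\<close>
    then obtain E0 where E0: "E0 \<in> F \<Q> w" by blast
    \<comment> \<open>The choice \<open>x = 1 / r\<close> makes both factors
      \<open>exp (o(1) n^2)\<close> as \<open>r\<close> grows.\<close>
    have "real (card (F \<Q> w)) \<le> (1 + 1 / real r) ^ card ([V]\<^bsup>2\<^esup>) / (1 / real r) ^ (3 * ?n\<^sup>2 div r)"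
    proof (rule sauer_shelah_exp[OF finU])
      show "F \<Q> w \<subseteq> Pow ([V]\<^bsup>2\<^esup>)" by (auto simp: F_def)
      show "0 < 1 / real r" "1 / real r \<le> 1" using assms(2) by auto
      fix S assume S: "S \<subseteq> [V]\<^bsup>2\<^esup>" "shatters (F \<Q> w) S"
      show "card S \<le> 3 * ?n\<^sup>2 div r"
      proof (rule shattered_card[OF S(2) assms(1,2) S(1)])
        show "arrangement V E0 r \<Q>" using E0 by (simp add: F_def)
        show "C5_free V E" if "E \<in> F \<Q> w" for E using that by (simp add: F_def)
        fix E e assume "E \<in> F \<Q> w" "e \<in> ?D \<Q>"
        then show "e \<in> E \<longleftrightarrow> e \<in> E0" using E0 unfolding F_def by blast
      qed
    qed
    also have "\<dots> = (1 + 1 / real r) ^ card ([V]\<^bsup>2\<^esup>) * real r ^ (3 * ?n\<^sup>2 div r)"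
      by (simp add: power_one_over)
    also have "\<dots> \<le> ?c"
      using cardU by (intro mult_right_mono power_increasing) auto
    finally show ?thesis .
  qed simp
  have "?\<B> \<subseteq> (\<Union>\<Q>\<in>P. \<Union>w\<in>Pow (?D \<Q>). F \<Q> w)"
  proof
    fix E assume E: "E \<in> ?\<B>"
    then have H: "\<And>A c. A \<subseteq> V \<Longrightarrow> homog E c A \<Longrightarrow> r ^ 7 * card A < ?n" by blast
    have "\<exists>\<Q>. arrangement V E r \<Q>"
      by (rule arrangement_exists[where N = N, OF assms(1-3) H N n])
    then obtain \<Q> where "arrangement V E r \<Q>" ..
    then have "\<Q> \<in> P" "E \<in> F \<Q> (E \<inter> ?D \<Q>)" using E by (auto simp: P_def F_def)
    then show "E \<in> (\<Union>\<Q>\<in>P. \<Union>w\<in>Pow (?D \<Q>). F \<Q> w)"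
      by (intro UN_I[of \<Q>] UN_I[of "E \<inter> ?D \<Q>"] PowI Int_lower2)
  qed
  moreover have "finite (F \<Q> w)" for \<Q> w
    by (rule finite_subset[of _ "Pow ([V]\<^bsup>2\<^esup>)"]) (use finU in \<open>auto simp: F_def\<close>)
  ultimately have "card ?\<B> \<le> card (\<Union>\<Q>\<in>P. \<Union>w\<in>Pow (?D \<Q>). F \<Q> w)"
    using finP finU by (intro card_mono) auto
  also have "\<dots> \<le> (\<Sum>\<Q>\<in>P. card (\<Union>w\<in>Pow (?D \<Q>). F \<Q> w))"
    by (rule card_UN_le[OF finP])
  also have "\<dots> \<le> (\<Sum>\<Q>\<in>P. \<Sum>w\<in>Pow (?D \<Q>). card (F \<Q> w))"
    using finU by (intro sum_mono card_UN_le) auto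
  finally have "real (card ?\<B>) \<le> real (\<Sum>\<Q>\<in>P. \<Sum>w\<in>Pow (?D \<Q>). card (F \<Q> w))"
    by (simp only: of_nat_le_iff)
  also have "\<dots> = (\<Sum>\<Q>\<in>P. \<Sum>w\<in>Pow (?D \<Q>). real (card (F \<Q> w)))" by simp
  also have "\<dots> \<le> (\<Sum>\<Q>\<in>P. \<Sum>w\<in>Pow (?D \<Q>). ?c)"
    by (intro sum_mono cF)
  also have "\<dots> = (\<Sum>\<Q>\<in>P. 2 ^ card (?D \<Q>) * ?c)"
    using finU by (simp add: card_Pow)
  also have "\<dots> \<le> (\<Sum>\<Q>\<in>P. ?b * ?c)"
  proof (intro sum_mono mult_right_mono power_increasing)
    fix \<Q> assume "\<Q> \<in> P"
    then show "card (?D \<Q>) \<le> 2 * ?n * (?n div r + 1)"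
      unfolding P_def arrangement_def by (intro card_not_crossing[OF assms(1)]) blast+
  qed auto
  also have "\<dots> = real (card P) * (?b * ?c)" by simp
  also have "\<dots> \<le> real ?a * (?b * ?c)"
  proof (intro mult_right_mono of_nat_mono)
    have "card P \<le> card {\<Q>. \<Q> \<subseteq> Pow V \<and> card \<Q> \<le> r ^ 4}"
      by (rule card_mono[OF _ P], rule finite_subset[of _ "Pow (Pow V)"]) (use assms(1) in auto)
    then show "card P \<le> ?a" using card_small_families[OF assms(1), of "r ^ 4"] by linarith
  qed simp
  finally show ?thesis .
qed

section \<open>Split graphs\<close>

text \<open>In an induced five-cycle the vertices inside \<open>A\<close> would cover all edges,
  which takes at least three of them, and be pairwise adjacent, which allows at most two.\<close>

lemma split_graph_C5_free:
  assumes A: "\<And>x y. x \<in> A \<Longrightarrow> y \<in> A \<Longrightarrow> x \<noteq> y \<Longrightarrow> {x, y} \<in> E"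
    and B: "\<And>x y. x \<in> V - A \<Longrightarrow> y \<in> V - A \<Longrightarrow> x \<noteq> y \<Longrightarrow> {x, y} \<notin> E"
  shows "C5_free V E"
  unfolding C5_free_def
proof
  assume "has_induced_copy V E {..<5} (cycle_edges 5)"
  then obtain f :: "nat \<Rightarrow> 'a" where f: "inj_on f {..<5}" "f ` {..<5} \<subseteq> V"
    "\<And>i j. i < 5 \<Longrightarrow> j < 5 \<Longrightarrow> i \<noteq> j \<Longrightarrow> {f i, f j} \<in> E \<longleftrightarrow> {i, j} \<in> cycle_edges 5"
    unfolding has_induced_copy_def by (metis lessThan_iff)
  have ne: "f i \<noteq> f j" if "i < 5" "j < 5" "i \<noteq> j" for i j
    using f(1) that by (auto simp: inj_on_def)
  have V: "f i \<in> V" if "i < 5" for i using f(2) that by auto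
  have edge: "f i \<in> A \<or> f j \<in> A" if "i < 5" "j < 5" "i \<noteq> j" "{i, j} \<in> cycle_edges 5" for i j
    using B[of "f i" "f j"] V that f(3) ne by auto
  have nonedge: "f i \<notin> A \<or> f j \<notin> A" if "i < 5" "j < 5" "i \<noteq> j" "{i, j} \<notin> cycle_edges 5" for i j
    using A[of "f i" "f j"] that f(3) ne by auto
  have "f 0 \<in> A \<or> f 1 \<in> A" "f 1 \<in> A \<or> f 2 \<in> A" "f 2 \<in> A \<or> f 3 \<in> A" "f 3 \<in> A \<or> f 4 \<in> A" "f 4 \<in> A \<or> f 0 \<in> A"
    by (intro edge; simp add: cycle_edges_5 doubleton_eq_iff)+
  moreover have "f 0 \<notin> A \<or> f 2 \<notin> A" "f 1 \<notin> A \<or> f 3 \<notin> A" "f 2 \<notin> A \<or> f 4 \<notin> A" "f 3 \<notin> A \<or> f 0 \<notin> A" "f 4 \<notin> A \<or> f 1 \<notin> A"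
    by (intro nonedge; simp add: cycle_edges_5 doubleton_eq_iff)+
  ultimately show False by argo
qed

text \<open>A clique on the first \<open>a\<close> vertices, no edges among the rest, and an
  arbitrary choice of the remaining edges between the two sides.\<close>

lemma card_forb_C5_ge:
  fixes n a :: nat and c :: real
  defines "m \<equiv> nat \<lfloor>c * real (n choose 2)\<rfloor>"
  assumes "a \<le> n" "a choose 2 \<le> m"
  shows "(a * (n - a)) choose (m - (a choose 2)) \<le> card (forb_C5 n c)"
proof -
  let ?A = "{1..a}" and ?B = "{a+1..n}"
  define K where "K = (\<lambda>(x, y). {x, y}) ` (?A \<times> ?B)"
  have "inj_on (\<lambda>(x, y). {x, y}) (?A \<times> ?B)"
    by (auto simp: inj_on_def doubleton_eq_iff)
  then have cK: "card K = a * (n - a)" by (simp add: K_def card_image card_cartesian_product)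
  have finK: "finite K" by (simp add: K_def)
  have K: "K \<subseteq> [{1..n}]\<^bsup>2\<^esup>" using assms(2) by (auto simp: K_def nsets_def)
  have AK: "[?A]\<^bsup>2\<^esup> \<inter> K = {}" by (auto simp: K_def nsets_def)
  have An: "[?A]\<^bsup>2\<^esup> \<subseteq> [{1..n}]\<^bsup>2\<^esup>" using assms(2) by (intro nsets_mono) auto
  have finA: "finite ([?A]\<^bsup>2\<^esup>)" "card ([?A]\<^bsup>2\<^esup>) = a choose 2"
    by (simp_all add: finite_imp_finite_nsets card_nsets)
  define \<T> where "\<T> = {T. T \<subseteq> K \<and> card T = m - (a choose 2)}"
  have "(\<lambda>T. [?A]\<^bsup>2\<^esup> \<union> T) ` \<T> \<subseteq> forb_C5 n c"
  proof
    fix E assume "E \<in> (\<lambda>T. [?A]\<^bsup>2\<^esup> \<union> T) ` \<T>"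
    then obtain T where T: "E = [?A]\<^bsup>2\<^esup> \<union> T" "T \<subseteq> K" "card T = m - (a choose 2)"
      by (auto simp: \<T>_def)
    have "card E = card ([?A]\<^bsup>2\<^esup>) + card T"
      unfolding T(1) using finA(1) AK T(2) finK by (intro card_Un_disjoint) (auto intro: finite_subset)
    then have "card E = m" using T(3) assms(3) finA(2) by simp
    moreover have "C5_free {1..n} E"
    proof (rule split_graph_C5_free[of ?A])
      show "{x, y} \<in> E" if "x \<in> ?A" "y \<in> ?A" "x \<noteq> y" for x y
        using that unfolding T(1) by (auto simp: nsets_def)
      show "{x, y} \<notin> E" if "x \<in> {1..n} - ?A" "y \<in> {1..n} - ?A" "x \<noteq> y" for x y
        using that T(2) unfolding T(1) by (auto simp: nsets_def K_def doubleton_eq_iff)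
    qed
    ultimately show "E \<in> forb_C5 n c"
      using T K An by (auto simp: forb_C5_def m_def C5_free_def)
  qed
  moreover have "finite (forb_C5 n c)"
    by (rule finite_subset[of _ "Pow ([{1..n}]\<^bsup>2\<^esup>)"]) (auto simp: forb_C5_def finite_imp_finite_nsets)
  moreover have "inj_on (\<lambda>T. [?A]\<^bsup>2\<^esup> \<union> T) \<T>"
    using AK unfolding inj_on_def \<T>_def by blast
  ultimately have "card \<T> \<le> card (forb_C5 n c)" by (metis card_image card_mono)
  moreover have "card \<T> = (a * (n - a)) choose (m - (a choose 2))"
    unfolding \<T>_def using n_subsets[OF finK] cK by simp
  ultimately show ?thesis by simp
qed

text \<open>With a clique on about \<open>c * n\<close> vertices, the number \<open>e\<close> of
  edges still to be placed is about half of the \<open>N\<close> available positions, so the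
  binomial coefficient is exponential in \<open>n ^ 2\<close>.\<close>

lemma card_forb_C5_lower:
  fixes c :: real
  assumes "0 < c" "c < 1"
  obtains \<delta> :: real where "\<delta> > 0"
    "eventually (\<lambda>n. exp (\<delta> * real n ^ 2) \<le> real (card (forb_C5 n c))) sequentially"
proof -
  \<comment> \<open>From \<open>e \<ge> N / 4\<close> and
    \<open>N \<ge> c * (1 - c) / 2 * n ^ 2\<close>; the base \<open>4 / 3\<close> is the bound on
    \<open>N / e\<close>.\<close>
  define \<delta> where "\<delta> = ln (4 / 3) * (c * (1 - c) / 8)"
  have "eventually (\<lambda>n. exp (\<delta> * real n ^ 2) \<le> real (card (forb_C5 n c))) sequentially"
    using eventually_ge_at_top[of "nat \<lceil>8 / (c * (1 - c))\<rceil>"] eventually_gt_at_top[of 0]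
  proof eventually_elim
    fix n :: nat assume n0: "nat \<lceil>8 / (c * (1 - c))\<rceil> \<le> n" "0 < n"
    have "8 / (c * (1 - c)) \<le> real n" using n0(1) by linarith
    then have n: "8 \<le> c * (1 - c) * real n" using assms by (simp add: field_simps)
    define a where "a = nat \<lfloor>c * real n\<rfloor>"
    define m where "m = nat \<lfloor>c * real (n choose 2)\<rfloor>"
    define N where "N = a * (n - a)"
    define e where "e = m - (a choose 2)"
    have a: "real a \<le> c * real n" "c * real n < real a + 1"
      using assms unfolding a_def by (simp_all add: of_nat_floor)
    have cn: "c * real n \<le> real n" using assms by (simp add: mult_left_le_one_le)
    have an: "a \<le> n" using a(1) cn by linarith
    have ch: "2 * real (k choose 2) = real k * (real k - 1)" for k
      using arg_cong[OF choose_two[of k], of real] by (cases k) (simp_all add: real_of_nat_div algebra_simps)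
    have m: "real m \<le> c * real (n choose 2)" "c * real (n choose 2) < real m + 1"
      using assms unfolding m_def by (simp_all add: of_nat_floor)
    have N: "real N = real a * (real n - real a)" using an by (simp add: N_def of_nat_diff)
    have cm: "2 * (c * real (n choose 2)) = c * real n * (real n - 1)"
      using arg_cong[OF ch[of n], of "\<lambda>x. c * x"] by (simp only: mult.assoc mult.left_commute)
    have "real a * (real n - 1) \<le> c * real n * (real n - 1)"
      using a(1) n0(2) by (intro mult_right_mono) auto
    then have lo: "real a * (real n - 1) \<le> 2 * real m + 2" using m(2) cm by linarith
    have "c * real n * (real n - 1) \<le> (real a + 1) * (real n - 1)"
      using a(2) n0(2) by (intro mult_right_mono) auto
    then have hi: "2 * real m \<le> real a * (real n - 1) + real n"
      using m(1) cm by (simp add: algebra_simps)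
    have "(c * real n - 1) * (real n - c * real n) \<le> real a * (real n - real a)"
      using a cn by (intro mult_mono) auto
    moreover have "(2 * (1 - c)) * real n \<le> (c * (1 - c) * real n) * real n"
      using n assms by (intro mult_right_mono) auto
    moreover have "(c * real n - 1) * (real n - c * real n) = c * (1 - c) * real n ^ 2 - (1 - c) * real n"
      "(c * (1 - c) * real n) * real n = c * (1 - c) * real n ^ 2"
      "c * (1 - c) / 2 * real n ^ 2 = (c * (1 - c) * real n ^ 2) / 2"
      by (simp_all add: power2_eq_square algebra_simps)
    ultimately have Nn: "c * (1 - c) / 2 * real n ^ 2 \<le> real N"
      unfolding N by linarith
    have "8 * real n \<le> (c * (1 - c) * real n) * real n"
      using n by (intro mult_right_mono) auto
    moreover have "(c * (1 - c) * real n) * real n = 2 * (c * (1 - c) / 2 * real n ^ 2)"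
      by (simp add: power2_eq_square)
    ultimately have N4: "4 * real n \<le> real N" using Nn by linarith
    have n1: "1 \<le> real n" using n0(2) by simp
    \<comment> \<open>With this identity \<open>lo\<close> and \<open>hi\<close> become
      \<open>N - 2 \<le> 2 * e \<le> N + n\<close>, and \<open>4 * n \<le> N\<close> absorbs the
      rounding errors.\<close>
    have Na: "real N = real a * (real n - 1) - 2 * real (a choose 2)"
      unfolding N ch by (simp add: algebra_simps)
    have "real (a choose 2) \<le> real m" using Na lo N4 n1 by linarith
    then have am: "a choose 2 \<le> m" by simp
    have e: "real e = real m - real (a choose 2)" using am by (simp add: e_def of_nat_diff)
    have e1: "real N \<le> 4 * real e" using Na lo N4 n1 e by linarith
    have e2: "4 * real e \<le> 3 * real N" using Na hi N4 n1 e by linarith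
    have e0: "real e > 0" "e \<le> N" using e1 e2 N4 n1 by linarith+
    have "\<delta> * real n ^ 2 = ln (4 / 3) * ((c * (1 - c) / 2 * real n ^ 2) / 4)"
      by (simp add: \<delta>_def)
    also have "\<dots> \<le> ln (4 / 3) * real e"
      using Nn e1 by (intro mult_left_mono) auto
    finally have "exp (\<delta> * real n ^ 2) \<le> exp (real e * ln (4 / 3))" by (simp add: mult.commute)
    also have "\<dots> = (4 / 3) ^ e" by (simp add: exp_of_nat_mult)
    also have "\<dots> \<le> (real N / real e) ^ e"
      using e0 e2 by (intro power_mono) (auto simp: field_simps)
    also have "\<dots> \<le> real (N choose e)"
      using binomial_ge_n_over_k_pow_k[OF e0(2), where ?'a = real] by simp
    also have "\<dots> \<le> real (card (forb_C5 n c))"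
      using card_forb_C5_ge[OF an, of c] am by (simp add: N_def e_def m_def)
    finally show "exp (\<delta> * real n ^ 2) \<le> real (card (forb_C5 n c))" .
  qed
  moreover have "\<delta> > 0" using assms by (simp add: \<delta>_def)
  ultimately show ?thesis using that by blast
qed

section \<open>Asymptotics\<close>

text \<open>The coefficient of \<open>n ^ 2\<close> collects \<open>2 / r\<close> from the fixed
  pairs, and \<open>1 / r\<close> and \<open>3 * ln r / r\<close> from the Sauer-Shelah bound; it
  tends to 0 as \<open>r\<close> grows.\<close>

lemma count_bound_exp:
  fixes n r :: nat
  assumes "r > 0"
  shows "real ((r ^ 4 + 1) * 2 ^ (n * r ^ 4)) * (2 ^ (2 * n * (n div r + 1)) *
       ((1 + 1 / real r) ^ (n\<^sup>2) * real r ^ (3 * n\<^sup>2 div r)))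
    \<le> exp ((3 + 3 * ln (real r)) / real r * real n ^ 2 + (real r ^ 4 + 2) * real n + real r ^ 4)"
proof -
  have two: "(2::real) ^ k \<le> exp (real k)" for k
  proof -
    have "(2::real) ^ k \<le> exp 1 ^ k"
      using exp_ge_add_one_self[of 1] by (intro power_mono) auto
    then show ?thesis by (simp add: exp_of_nat_mult[symmetric])
  qed
  have r: "1 \<le> real r" using assms by simp
  have "real (r ^ 4 + 1) \<le> exp (real r ^ 4)"
    using exp_ge_add_one_self[of "real r ^ 4"] by (simp add: add.commute)
  moreover have "2 ^ (n * r ^ 4) \<le> exp (real n * real r ^ 4)"
    using two[of "n * r ^ 4"] by simp
  ultimately have 1: "real ((r ^ 4 + 1) * 2 ^ (n * r ^ 4)) \<le> exp (real r ^ 4) * exp (real n * real r ^ 4)"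
    unfolding of_nat_mult of_nat_power of_nat_numeral by (intro mult_mono) auto
  have "2 ^ (2 * n * (n div r + 1)) \<le> exp (real (2 * n * (n div r + 1)))"
    by (rule two)
  also have "real (2 * n * (n div r + 1)) = 2 * real n * (real (n div r) + 1)" by (simp add: algebra_simps)
  also have "\<dots> \<le> 2 * real n * (real n / real r + 1)"
    by (intro mult_left_mono add_right_mono of_nat_div_le_of_nat) auto
  finally have 2: "2 ^ (2 * n * (n div r + 1)) \<le> exp (2 * real n * (real n / real r + 1))" by simp
  have "(1 + 1 / real r) ^ (n\<^sup>2) \<le> exp (1 / real r) ^ (n\<^sup>2)"
    using exp_ge_add_one_self[of "1 / real r"] by (intro power_mono) auto
  also have "\<dots> = exp (real n ^ 2 / real r)"
    by (simp add: exp_of_nat_mult[symmetric])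
  finally have 3: "(1 + 1 / real r) ^ (n\<^sup>2) \<le> exp (real n ^ 2 / real r)" .
  have "real r ^ (3 * n\<^sup>2 div r) = exp (real (3 * n\<^sup>2 div r) * ln (real r))"
    using assms by (simp add: exp_of_nat_mult)
  also have "real (3 * n\<^sup>2 div r) * ln (real r) \<le> 3 * real n ^ 2 / real r * ln (real r)"
    using of_nat_div_le_of_nat[of "3 * n\<^sup>2" r, where ?'a = real] r by (intro mult_right_mono) auto
  finally have 4: "real r ^ (3 * n\<^sup>2 div r) \<le> exp (3 * real n ^ 2 / real r * ln (real r))" by simp
  have "real ((r ^ 4 + 1) * 2 ^ (n * r ^ 4)) * (2 ^ (2 * n * (n div r + 1)) *
       ((1 + 1 / real r) ^ (n\<^sup>2) * real r ^ (3 * n\<^sup>2 div r)))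
    \<le> (exp (real r ^ 4) * exp (real n * real r ^ 4)) * (exp (2 * real n * (real n / real r + 1)) *
       (exp (real n ^ 2 / real r) * exp (3 * real n ^ 2 / real r * ln (real r))))"
    using 1 2 3 4 by (intro mult_mono) auto
  also have "\<dots> = exp ((3 + 3 * ln (real r)) / real r * real n ^ 2 + (real r ^ 4 + 2) * real n + real r ^ 4)"
    unfolding exp_add[symmetric] by (simp add: algebra_simps add_divide_distrib power2_eq_square)
  finally show ?thesis .
qed

lemma hom_ge:
  assumes "finite V" "A \<subseteq> V" "homog E b A"
  shows "card A \<le> hom V E"
proof -
  let ?H = "{card S | S. S \<subseteq> V \<and> (clique S E \<or> indep S E)}"
  have "finite ?H" by (rule finite_subset[of _ "card ` Pow V"]) (use assms(1) in auto)
  moreover have "clique A E \<or> indep A E"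
    using assms(3) homog_clique_indep by (cases b) auto
  then have "card A \<in> ?H" using assms(2) by blast
  ultimately show ?thesis unfolding hom_def by (rule Max_ge)
qed

text \<open>The threshold \<open>1 / r ^ 7\<close> is the bound on homogeneous sets required above.
  The Ramsey number \<open>N\<close> depends only on \<open>r\<close>, so
  \<open>r ^ 5 * N \<le> n\<close> holds eventually.\<close>

lemma card_forb_C5_hom_upper:
  fixes r :: nat and c :: real
  assumes "r > 0"
  shows "eventually (\<lambda>n. real (card (forb_C5_hom n (1 / real r ^ 7) c)) \<le>
    exp ((3 + 3 * ln (real r)) / real r * real n ^ 2 + (real r ^ 4 + 2) * real n + real r ^ 4)) sequentially"
proof -
  from ramsey_homog obtain N where N': "\<forall>E. \<forall>B :: nat set. finite B \<and> N \<le> card B \<longrightarrow>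
    (\<exists>R\<subseteq>B. card R = r \<and> (\<exists>b. homog E b R))" ..
  have N: "\<exists>R\<subseteq>B. card R = r \<and> (\<exists>b. homog E b R)" if "finite B" "N \<le> card B" for E and B :: "nat set"
    by (rule N'[rule_format]) (use that in simp)
  show ?thesis
    using eventually_ge_at_top[of "r ^ 5 * N"] eventually_gt_at_top[of 0]
  proof eventually_elim
    fix n :: nat assume n: "r ^ 5 * N \<le> n" "0 < n"
    let ?V = "{1..n}"
    let ?B = "{E. E \<subseteq> [?V]\<^bsup>2\<^esup> \<and> C5_free ?V E \<and>
      (\<forall>A c. A \<subseteq> ?V \<longrightarrow> homog E c A \<longrightarrow> r ^ 7 * card A < card ?V)}"
    have "forb_C5_hom n (1 / real r ^ 7) c \<subseteq> ?B"
    proof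
      fix E assume "E \<in> forb_C5_hom n (1 / real r ^ 7) c"
      then have E: "E \<subseteq> [?V]\<^bsup>2\<^esup>" "C5_free ?V E" "real (hom ?V E) < 1 / real r ^ 7 * real n"
        by (auto simp: forb_C5_hom_def forb_C5_def C5_free_def)
      have "r ^ 7 * card A < card ?V" if "A \<subseteq> ?V" "homog E b A" for A b
      proof -
        have "real r ^ 7 * real (card A) \<le> real r ^ 7 * real (hom ?V E)"
          using hom_ge[of ?V A E b] that by (intro mult_left_mono) auto
        also have "\<dots> < real n" using E(3) assms by (simp add: field_simps)
        finally have "real (r ^ 7 * card A) < real n" by simp
        then show ?thesis by (simp only: of_nat_less_iff card_atLeastAtMost diff_Suc_1 One_nat_def)
      qed
      then show "E \<in> ?B" using E by blast
    qed
    moreover have "finite ?B"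
      by (rule finite_subset[of _ "Pow ([?V]\<^bsup>2\<^esup>)"]) (auto simp: finite_imp_finite_nsets)
    ultimately have "card (forb_C5_hom n (1 / real r ^ 7) c) \<le> card ?B" by (rule card_mono[rotated])
    then have "real (card (forb_C5_hom n (1 / real r ^ 7) c)) \<le> real (card ?B)" by simp
    also note card_C5_free_small_homog[of ?V r N, OF _ assms _ N]
    also note count_bound_exp[OF assms]
    finally show "real (card (forb_C5_hom n (1 / real r ^ 7) c)) \<le>
      exp ((3 + 3 * ln (real r)) / real r * real n ^ 2 + (real r ^ 4 + 2) * real n + real r ^ 4)"
      using n by simp
  qed
qed

theorem theorem1p3:
  fixes c :: real
  assumes "0 < c" and "c < 1"
  shows "\<exists>\<eta>>0. (\<lambda>n. real (card (forb_C5_hom n \<eta> c)) / real (card (forb_C5 n c))) \<longlonglongrightarrow> 0"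
proof -
  obtain \<delta> where \<delta>: "\<delta> > 0"
    and lower: "eventually (\<lambda>n. exp (\<delta> * real n ^ 2) \<le> real (card (forb_C5 n c))) sequentially"
    using card_forb_C5_lower[OF assms] .
  \<comment> \<open>As \<open>\<delta>\<close> depends only on \<open>c\<close>, \<open>r\<close>
    can be chosen afterwards so that the upper exponent falls below it.\<close>
  have "(\<lambda>r. (3 + 3 * ln (real r)) / real r) \<longlonglongrightarrow> 0" by real_asymp
  then have "eventually (\<lambda>r. (3 + 3 * ln (real r)) / real r < \<delta>) sequentially"
    using \<delta> by (rule order_tendstoD)
  then have "eventually (\<lambda>r. r > 0 \<and> (3 + 3 * ln (real r)) / real r < \<delta>) sequentially"
    using eventually_gt_at_top[of 0] by eventually_elim auto
  from eventually_happens'[OF sequentially_bot this]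
  obtain r :: nat where r: "r > 0" "(3 + 3 * ln (real r)) / real r < \<delta>" by blast
  \<comment> \<open>The surplus in the quadratic term, which outweighs the linear and constant terms
    of the upper bound.\<close>
  define \<gamma> where "\<gamma> = \<delta> - (3 + 3 * ln (real r)) / real r"
  define a where "a = real r ^ 4 + 2"
  define b where "b = real r ^ 4"
  have \<gamma>: "\<gamma> > 0" using r(2) by (simp add: \<gamma>_def)
  let ?q = "\<lambda>n. real (card (forb_C5_hom n (1 / real r ^ 7) c)) / real (card (forb_C5 n c))"
  have "?q \<longlonglongrightarrow> 0"
  proof (rule tendsto_sandwich)
    show "eventually (\<lambda>n. 0 \<le> ?q n) sequentially" by simp
    show "eventually (\<lambda>n. ?q n \<le> exp (a * real n + b - \<gamma> * real n ^ 2)) sequentially"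
      using lower card_forb_C5_hom_upper[OF r(1), of c]
    proof eventually_elim
      fix n :: nat
      let ?u = "exp ((3 + 3 * ln (real r)) / real r * real n ^ 2 + (real r ^ 4 + 2) * real n + real r ^ 4)"
      assume "exp (\<delta> * real n ^ 2) \<le> real (card (forb_C5 n c))"
        "real (card (forb_C5_hom n (1 / real r ^ 7) c)) \<le> ?u"
      then have "?q n \<le> ?u / exp (\<delta> * real n ^ 2)" by (intro frac_le) auto
      also have "\<dots> = exp (a * real n + b - \<gamma> * real n ^ 2)"
        unfolding exp_diff[symmetric] a_def b_def \<gamma>_def by (simp add: algebra_simps)
      finally show "?q n \<le> exp (a * real n + b - \<gamma> * real n ^ 2)" .
    qed
    show "(\<lambda>n. 0 :: real) \<longlonglongrightarrow> 0" by simp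
    show "(\<lambda>n. exp (a * real n + b - \<gamma> * real n ^ 2)) \<longlonglongrightarrow> 0"
      using \<gamma> by real_asymp
  qed
  moreover have "1 / real r ^ 7 > 0" using r(1) by simp
  ultimately show ?thesis by blast
qed

end
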